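(* For the Ornstein–Uhlenbeck process $\{X_t\}_{t\ge0}$, let $\mu_t$ denote the law of $X_t$ and $p_t$ its density. For arbitrary $s=\Omega(d)$, there exists an initial distribution $\mu$ (the law of $X_0$) which is $O(1)$-log-smooth but such that for every $t\ge\frac{\log 10}{2}$ there is a point $x$ with $\|\nabla^2\log p_t(x)\|_{\mathrm{op}}\ge \Omega(e^{-2t}s-1)$.
   Context: The Ornstein–Uhlenbeck process is the solution of $\mathrm dX_t=-X_t\,\mathrm dt+\sqrt2\,\mathrm dB_t$ with $\{B_t\}$ a standard Brownian motion on $\mathbb R^d$. A distribution with density $\propto e^{-f}$ is $L$-log-smooth if $\nabla f$ is $L$-Lipschitz. $\|\cdot\|_{\mathrm{op}}$ is the operator norm. *)

theory Defs
  imports "HOL-Probability.Probability"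
begin

text \<open>
  The constants hidden in the \<open>O\<close> and \<open>\<Omega>\<close> notation must not depend on the dimension \<open>d\<close>, so \<open>d\<close>
  has to be quantified inside the formula. Hence \<open>\<real>\<^sup>d\<close> is not a type such as \<open>real ^ 'n\<close>, but the set
  of functions on the index set \<open>{..<d}\<close> (extended by \<open>undefined\<close>), which is the
  underlying space of the product measure below.
\<close>

abbreviation euc :: "nat \<Rightarrow> (nat \<Rightarrow> real) set" where
  "euc d \<equiv> {..<d} \<rightarrow>\<^sub>E UNIV"

abbreviation leb :: "nat \<Rightarrow> (nat \<Rightarrow> real) measure" where
  "leb d \<equiv> Pi\<^sub>M {..<d} (\<lambda>_. lborel)"

abbreviation enorm :: "nat \<Rightarrow> (nat \<Rightarrow> real) \<Rightarrow> real" where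
  "enorm d v \<equiv> L2_set v {..<d}"

text \<open>\<open>f\<close> is Frechet differentiable at \<open>x\<close> with gradient \<open>g\<close>.\<close>

definition has_gradient ::
  "nat \<Rightarrow> ((nat \<Rightarrow> real) \<Rightarrow> real) \<Rightarrow> (nat \<Rightarrow> real) \<Rightarrow> (nat \<Rightarrow> real) \<Rightarrow> bool" where
  "has_gradient d f g x \<longleftrightarrow>
     (\<forall>e>0. \<exists>r>0. \<forall>y\<in>euc d. enorm d (\<lambda>i. y i - x i) < r \<longrightarrow>
        \<bar>f y - f x - (\<Sum>i<d. g i * (y i - x i))\<bar> \<le> e * enorm d (\<lambda>i. y i - x i))"

definition has_hessian ::
  "nat \<Rightarrow> ((nat \<Rightarrow> real) \<Rightarrow> real) \<Rightarrow> (nat \<Rightarrow> nat \<Rightarrow> real) \<Rightarrow> (nat \<Rightarrow> real) \<Rightarrow> bool" where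
  "has_hessian d f H x \<longleftrightarrow>
     (\<exists>G. (\<forall>y\<in>euc d. has_gradient d f (G y) y) \<and>
          (\<forall>i<d. has_gradient d (\<lambda>y. G y i) (H i) x))"

definition op_norm :: "nat \<Rightarrow> (nat \<Rightarrow> nat \<Rightarrow> real) \<Rightarrow> real" where
  "op_norm d A = (SUP v\<in>{v. enorm d v \<le> 1}. enorm d (\<lambda>i. \<Sum>j<d. A i j * v j))"

definition log_smooth :: "nat \<Rightarrow> real \<Rightarrow> (nat \<Rightarrow> real) measure \<Rightarrow> bool" where
  "log_smooth d L \<mu> \<longleftrightarrow> prob_space \<mu> \<and>
     (\<exists>f G Z. Z > 0 \<and> \<mu> = density (leb d) (\<lambda>x. ennreal (exp (- f x) / Z)) \<and>
        (\<forall>x\<in>euc d. has_gradient d f (G x) x) \<and>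
        (\<forall>x\<in>euc d. \<forall>y\<in>euc d.
           enorm d (\<lambda>i. G x i - G y i) \<le> L * enorm d (\<lambda>i. x i - y i)))"

definition brownian_motion_1d :: "'w measure \<Rightarrow> (real \<Rightarrow> 'w \<Rightarrow> real) \<Rightarrow> bool" where
  "brownian_motion_1d M B \<longleftrightarrow> prob_space M \<and>
     (\<forall>t\<ge>0. B t \<in> borel_measurable M) \<and>
     (AE \<omega> in M. B 0 \<omega> = 0) \<and>
     (\<forall>s t. 0 \<le> s \<and> s < t \<longrightarrow>
        distributed M lborel (\<lambda>\<omega>. B t \<omega> - B s \<omega>) (\<lambda>x. ennreal (normal_density 0 (sqrt (t - s)) x))) \<and>
     (\<forall>\<tau> n. 0 \<le> \<tau> 0 \<and> strict_mono \<tau> \<longrightarrow>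
        prob_space.indep_vars M (\<lambda>_. borel) (\<lambda>k \<omega>. B (\<tau> (Suc k)) \<omega> - B (\<tau> k) \<omega>) {..<n :: nat}) \<and>
     (AE \<omega> in M. continuous_on {0..} (\<lambda>t. B t \<omega>))"

text \<open>A standard Brownian motion on \<open>\<real>\<^sup>d\<close>; \<open>B t \<omega> i\<close> is the \<open>i\<close>-th coordinate at time \<open>t\<close>.\<close>

definition brownian_motion :: "nat \<Rightarrow> 'w measure \<Rightarrow> (real \<Rightarrow> 'w \<Rightarrow> nat \<Rightarrow> real) \<Rightarrow> bool" where
  "brownian_motion d M B \<longleftrightarrow> prob_space M \<and>
     (\<forall>i<d. brownian_motion_1d M (\<lambda>t \<omega>. B t \<omega> i)) \<and>
     prob_space.indep_vars M (\<lambda>_. Pi\<^sub>M {0..} (\<lambda>_. borel)) (\<lambda>i \<omega>. \<lambda>t\<in>{0..}. B t \<omega> i) {..<d}"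

text \<open>
  Solutions of \<open>dX = - X dt + sqrt 2 dB\<close> with \<open>X 0\<close> independent of \<open>B\<close>. The noise is additive, so the
  integral form of the equation involves no stochastic integral other than \<open>\<integral> dB = B t\<close>
  and can be stated path by path.
\<close>

definition ornstein_uhlenbeck ::
  "nat \<Rightarrow> 'w measure \<Rightarrow> (real \<Rightarrow> 'w \<Rightarrow> nat \<Rightarrow> real) \<Rightarrow> (real \<Rightarrow> 'w \<Rightarrow> nat \<Rightarrow> real) \<Rightarrow> bool" where
  "ornstein_uhlenbeck d M B X \<longleftrightarrow> brownian_motion d M B \<and>
     (\<forall>t\<ge>0. X t \<in> measurable M (leb d)) \<and>
     prob_space.indep_set M
       (sets (vimage_algebra (space M) (X 0) (leb d)))
       (sets (vimage_algebra (space M) (\<lambda>\<omega>. \<lambda>i\<in>{..<d}. \<lambda>t\<in>{0..}. B t \<omega> i)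
                (Pi\<^sub>M {..<d} (\<lambda>_. Pi\<^sub>M {0..} (\<lambda>_. borel))))) \<and>
     (AE \<omega> in M. \<forall>i<d. continuous_on {0..} (\<lambda>t. X t \<omega> i) \<and>
        (\<forall>t\<ge>0. X t \<omega> i = X 0 \<omega> i - integral {0..t} (\<lambda>u. X u \<omega> i) + sqrt 2 * B t \<omega> i))"

end

theory Submission
  imports Defs "HOL-Real_Asymp.Real_Asymp"
begin

text \<open>
  Take \<open>\<mu>\<close> to be a product of copies of the one-dimensional law with potential
  \<open>z\<^sup>2 / 2 + 2 k cos (z / sqrt k)\<close>, where \<open>k = 2 s\<close>. Its second derivative is bounded by \<open>3\<close>, but it has
  two wells at distance of order \<open>sqrt k\<close>, and these persist when the quadratic
  \<open>l z\<^sup>2 / 2\<close>, \<open>l = e\<^sup>-\<^sup>2\<^sup>t / (1 - e\<^sup>-\<^sup>2\<^sup>t) \<le> 1/9\<close>, is added. Up to a Gaussian factor, the density of a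
  coordinate of \<open>X t\<close> is the Laplace transform of the tilted law, so the second derivative of its
  logarithm at \<open>0\<close> is \<open>- 1 / (1 - e\<^sup>-\<^sup>2\<^sup>t)\<close> plus a multiple of the variance of the tilted law, which
  is at least \<open>(1 - l) k\<close>.
\<close>

subsection \<open>Separable functions and product measures\<close>

text \<open>The initial law is fixed before \<open>t\<close>, and the estimate has to hold for every
  \<open>k > 0\<close>, not just asymptotically. The variance of the tilted law is therefore bounded
  by an integration by parts with explicit constants instead of by Laplace's method around the
  wells. The threshold on \<open>t\<close> means \<open>exp (- 2 * t) \<le> 1 / 10\<close>, which
  keeps the added quadratic weaker than the curvature \<open>-1\<close> of the potential at the
  origin. Independent coordinates make the Hessian of the log-density diagonal, with equal entries
  at the origin, so its operator norm is a one-dimensional quantity and no constant sees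
  \<open>d\<close>. At the origin the tilted law is even, so its variance is a plain second moment.

  A second obstacle is that the process is an arbitrary solution of a pathwise equation: that the
  noise \<open>X t - exp (- t) * X 0\<close> is Gaussian and independent of \<open>X 0\<close> has
  to be derived. The noise is recovered as a limit of weighted sums of Brownian increments, hence as
  a measurable functional of the Brownian path.\<close>

lemma has_gradient_separable:
  assumes "\<And>i. i < d \<Longrightarrow> (U i has_real_derivative u i) (at (x i))"
  shows "has_gradient d (\<lambda>y. \<Sum>i<d. U i (y i)) u x"
  unfolding has_gradient_def
proof (intro allI impI)
  fix e :: real
  assume "e > 0"
  \<comment> \<open>The errors of the \<open>d\<close> coordinates have to add up to at most
    \<open>e\<close>; dividing by \<open>d + 1\<close> also covers \<open>d = 0\<close>.\<close>
  define e' where "e' = e / (real d + 1)"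
  have e': "e' > 0" using \<open>e > 0\<close> by (simp add: e'_def)
  have "\<exists>r>0. \<forall>y. \<bar>y - x i\<bar> < r \<longrightarrow> \<bar>U i y - U i (x i) - u i * (y - x i)\<bar> \<le> e' * \<bar>y - x i\<bar>"
    if "i < d" for i
    using assms[OF that] e'
    unfolding has_field_derivative_def has_derivative_within_alt by simp
  then obtain r where r: "r i > 0"
    "\<bar>y - x i\<bar> < r i \<Longrightarrow> \<bar>U i y - U i (x i) - u i * (y - x i)\<bar> \<le> e' * \<bar>y - x i\<bar>"
    if "i < d" for i y
    by metis
  \<comment> \<open>The inserted \<open>1\<close> keeps the set nonempty when
    \<open>d = 0\<close>.\<close>
  define R where "R = Min (insert 1 (r ` {..<d}))"
  have R: "R > 0" "i < d \<Longrightarrow> R \<le> r i" for i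
    using r(1) by (auto simp: R_def)
  have "\<bar>(\<Sum>i<d. U i (y i)) - (\<Sum>i<d. U i (x i)) - (\<Sum>i<d. u i * (y i - x i))\<bar>
          \<le> e * enorm d (\<lambda>i. y i - x i)" if y: "enorm d (\<lambda>i. y i - x i) < R" for y
  proof -
    have le: "\<bar>y i - x i\<bar> \<le> enorm d (\<lambda>i. y i - x i)" if "i < d" for i
      using member_le_L2_set[of "{..<d}" i "\<lambda>i. \<bar>y i - x i\<bar>"] that
      by (simp add: L2_set_def)
    have "\<bar>(\<Sum>i<d. U i (y i)) - (\<Sum>i<d. U i (x i)) - (\<Sum>i<d. u i * (y i - x i))\<bar>
        = \<bar>\<Sum>i<d. U i (y i) - U i (x i) - u i * (y i - x i)\<bar>"
      by (simp add: sum_subtractf)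
    also have "\<dots> \<le> (\<Sum>i<d. \<bar>U i (y i) - U i (x i) - u i * (y i - x i)\<bar>)"
      by (rule sum_abs)
    also have "\<dots> \<le> (\<Sum>i<d. e' * enorm d (\<lambda>i. y i - x i))"
    proof (rule sum_mono)
      fix i assume "i \<in> {..<d}"
      then have i: "i < d" by simp
      have "\<bar>y i - x i\<bar> < r i" using le[OF i] y R(2)[OF i] by linarith
      from r(2)[OF i this] show "\<bar>U i (y i) - U i (x i) - u i * (y i - x i)\<bar>
          \<le> e' * enorm d (\<lambda>i. y i - x i)"
        using mult_left_mono[OF le[OF i], of e'] e' by linarith
    qed
    also have "\<dots> = (real d * e') * enorm d (\<lambda>i. y i - x i)" by simp
    also have "\<dots> \<le> e * enorm d (\<lambda>i. y i - x i)"
      using \<open>e > 0\<close> by (intro mult_right_mono) (auto simp: e'_def divide_simps L2_set_nonneg)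
    finally show ?thesis .
  qed
  with R(1) show "\<exists>r>0. \<forall>y\<in>euc d. enorm d (\<lambda>i. y i - x i) < r \<longrightarrow>
        \<bar>(\<Sum>i<d. U i (y i)) - (\<Sum>i<d. U i (x i)) - (\<Sum>i<d. u i * (y i - x i))\<bar>
          \<le> e * enorm d (\<lambda>i. y i - x i)"
    by blast
qed

lemma has_hessian_separable:
  assumes "\<And>z. (U has_real_derivative U' z) (at z)"
    and "\<And>z. (U' has_real_derivative U'' z) (at z)"
  shows "has_hessian d (\<lambda>y. \<Sum>i<d. U (y i)) (\<lambda>i j. if i = j then U'' (x i) else 0) x"
  unfolding has_hessian_def
proof (intro exI[of _ "\<lambda>y i. U' (y i)"] conjI ballI allI impI)
  show "has_gradient d (\<lambda>y. \<Sum>i<d. U (y i)) (\<lambda>i. U' (y i)) y" for y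
    by (rule has_gradient_separable) (rule assms(1))
  fix i assume i: "i < d"
  \<comment> \<open>A single partial derivative is again a separable sum, with \<open>U'\<close> in
    slot \<open>i\<close> and zero in all others.\<close>
  have "has_gradient d (\<lambda>y. \<Sum>j<d. (if i = j then U' else (\<lambda>_. 0)) (y j))
      (\<lambda>j. if i = j then U'' (x i) else 0) x"
    by (rule has_gradient_separable) (auto intro: assms(2))
  moreover have "(\<Sum>j<d. (if i = j then U' else (\<lambda>_. 0)) (y j)) = U' (y i)" for y :: "nat \<Rightarrow> real"
    using i by (simp add: if_distrib[of "\<lambda>f. f _"] cong: if_cong)
  ultimately show "has_gradient d (\<lambda>y. U' (y i)) (\<lambda>j. if i = j then U'' (x i) else 0) x"
    by simp
qed

lemma op_norm_scalar_matrix: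
  assumes "d \<ge> 1" and A: "\<And>i j. i < d \<Longrightarrow> j < d \<Longrightarrow> A i j = (if i = j then a else 0)"
  shows "op_norm d A = \<bar>a\<bar>"
proof -
  have eq: "enorm d (\<lambda>i. \<Sum>j<d. A i j * v j) = \<bar>a\<bar> * enorm d v" for v
  proof -
    have "(\<Sum>j<d. A i j * v j) = a * v i" if "i < d" for i
    proof -
      have "(\<Sum>j<d. A i j * v j) = (\<Sum>j<d. if i = j then a * v j else 0)"
        using that by (intro sum.cong) (auto simp: A)
      then show ?thesis using that by simp
    qed
    then have "enorm d (\<lambda>i. \<Sum>j<d. A i j * v j) = enorm d (\<lambda>i. a * v i)"
      by (intro L2_set_cong) auto
    also have "\<dots> = \<bar>a\<bar> * enorm d v"
      by (simp add: L2_set_def power_mult_distrib sum_distrib_left[symmetric] real_sqrt_mult)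
    finally show ?thesis .
  qed
  \<comment> \<open>The first basis vector, available because \<open>d \<ge> 1\<close>, attains the
    supremum.\<close>
  define v :: "nat \<Rightarrow> real" where "v i = (if i = 0 then 1 else 0)" for i
  have "enorm d v = 1"
    using \<open>d \<ge> 1\<close> by (simp add: L2_set_def v_def if_distrib[of "\<lambda>x. x ^ 2"] cong: if_cong)
  then show ?thesis
    unfolding op_norm_def eq
    by (intro cSup_eq_maximum) (auto intro!: image_eqI[of _ _ v] mult_left_le)
qed

section \<open>Product densities and sums of independent vectors\<close>

text \<open>A product measure is determined by its values on boxes, and on a box the integrand
  splits into one-dimensional factors. This passes from independent coordinates to a Lebesgue
  density on the product space.\<close>

lemma PiM_density_lborel:
  fixes f :: "real \<Rightarrow> ennreal"
  assumes "finite I" and [measurable]: "f \<in> borel_measurable borel"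
    and "prob_space (density lborel f)"
  shows "Pi\<^sub>M I (\<lambda>_. density lborel f) = density (Pi\<^sub>M I (\<lambda>_. lborel)) (\<lambda>x. \<Prod>i\<in>I. f (x i))"
proof -
  interpret m: prob_space "density lborel f" by fact
  interpret P: product_prob_space "\<lambda>_. density lborel f" ..
  interpret L: product_sigma_finite "\<lambda>_. lborel :: real measure" ..
  have [measurable_cong]: "sets (density lborel f) = sets borel" by simp
  show ?thesis
  proof (rule P.PiM_eqI[symmetric, OF \<open>finite I\<close>])
    show "sets (density (Pi\<^sub>M I (\<lambda>_. lborel)) (\<lambda>x. \<Prod>i\<in>I. f (x i))) = sets (Pi\<^sub>M I (\<lambda>_. density lborel f))"
      by (simp, rule sets_PiM_cong) auto
    fix A :: "_ \<Rightarrow> real set"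
    assume A: "\<And>i. i \<in> I \<Longrightarrow> A i \<in> sets (density lborel f)"
    have [measurable]: "Pi\<^sub>E I A \<in> sets (Pi\<^sub>M I (\<lambda>_. lborel))"
      using A \<open>finite I\<close> by (intro sets_PiM_I_finite) auto
    have "emeasure (density (Pi\<^sub>M I (\<lambda>_. lborel)) (\<lambda>x. \<Prod>i\<in>I. f (x i))) (Pi\<^sub>E I A)
        = (\<integral>\<^sup>+x. (\<Prod>i\<in>I. f (x i)) * indicator (Pi\<^sub>E I A) x \<partial>Pi\<^sub>M I (\<lambda>_. lborel))"
      using \<open>finite I\<close> by (subst emeasure_density) auto
    also have "\<dots> = (\<integral>\<^sup>+x. (\<Prod>i\<in>I. f (x i) * indicator (A i) (x i)) \<partial>Pi\<^sub>M I (\<lambda>_. lborel))"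
      using \<open>finite I\<close>
      by (intro nn_integral_cong)
        (auto simp: prod.distrib space_PiM PiE_iff indicator_def prod_zero_iff split: if_splits)
    also have "\<dots> = (\<Prod>i\<in>I. \<integral>\<^sup>+x. f x * indicator (A i) x \<partial>lborel)"
      using A \<open>finite I\<close> by (intro L.product_nn_integral_prod) auto
    also have "\<dots> = (\<Prod>i\<in>I. emeasure (density lborel f) (A i))"
      using A by (intro prod.cong) (auto simp: emeasure_density)
    finally show "emeasure (density (Pi\<^sub>M I (\<lambda>_. lborel)) (\<lambda>x. \<Prod>i\<in>I. f (x i))) (Pi\<^sub>E I A)
        = (\<Prod>i\<in>I. emeasure (density lborel f) (A i))" .
  qed
qed

text \<open>The hypothesis on \<open>q\<close> says that it is the density of
  \<open>a * x + y\<close> for independent one-dimensional \<open>x\<close> and \<open>y\<close>. On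
  boxes the \<open>d\<close>-dimensional claim factors into copies of this case, applying Tonelli
  first in \<open>y\<close> and then in \<open>x\<close>.\<close>

lemma distr_affine_PiM:
  fixes m n :: "real \<Rightarrow> real"
  assumes "finite I" and [measurable]: "m \<in> borel_measurable borel" "n \<in> borel_measurable borel"
    and m: "prob_space (density lborel m)" and n: "prob_space (density lborel n)"
    and q: "\<And>x. ennreal (q x) = (\<integral>\<^sup>+z. ennreal (m z) * ennreal (n (x - a * z)) \<partial>lborel)"
    and [measurable]: "q \<in> borel_measurable borel"
  shows "distr (Pi\<^sub>M I (\<lambda>_. density lborel m) \<Otimes>\<^sub>M Pi\<^sub>M I (\<lambda>_. density lborel n)) (Pi\<^sub>M I (\<lambda>_. lborel))
           (\<lambda>(x, y). \<lambda>i\<in>I. a * x i + y i) = Pi\<^sub>M I (\<lambda>_. density lborel q)" (is "?L = ?R")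
    and "prob_space (density lborel q)"
proof -
  interpret m: prob_space "density lborel m" by fact
  interpret n: prob_space "density lborel n" by fact
  interpret P: product_prob_space "\<lambda>_. density lborel m" I ..
  interpret N: product_prob_space "\<lambda>_. density lborel n" I ..
  have [measurable_cong]: "sets (density lborel m) = sets borel" "sets (density lborel n) = sets borel"
    "sets (density lborel q) = sets borel" by simp_all
  \<comment> \<open>The one-dimensional case, by the substitution \<open>w = a * x + y\<close> and
    Tonelli. With \<open>A = UNIV\<close> it also shows that \<open>q\<close> has total mass
    1.\<close>
  have K: "(\<integral>\<^sup>+x. (\<integral>\<^sup>+y. indicator A (a * x + y) \<partial>density lborel n) \<partial>density lborel m)
      = emeasure (density lborel q) A" if [measurable]: "A \<in> sets borel" for A
  proof -
    have "(\<integral>\<^sup>+x. (\<integral>\<^sup>+y. indicator A (a * x + y) \<partial>density lborel n) \<partial>density lborel m)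
       = (\<integral>\<^sup>+x. ennreal (m x) * (\<integral>\<^sup>+y. ennreal (n y) * indicator A (a * x + y) \<partial>lborel) \<partial>lborel)"
      by (simp add: nn_integral_density)
    also have "\<dots> = (\<integral>\<^sup>+x. ennreal (m x) * (\<integral>\<^sup>+w. ennreal (n (w - a * x)) * indicator A w \<partial>lborel) \<partial>lborel)"
    proof (rule nn_integral_cong, rule arg_cong2[of _ _ _ _ "(*)"], rule refl)
      fix x
      show "(\<integral>\<^sup>+y. ennreal (n y) * indicator A (a * x + y) \<partial>lborel)
          = (\<integral>\<^sup>+w. ennreal (n (w - a * x)) * indicator A w \<partial>lborel)"
        by (subst (2) nn_integral_real_affine[where c = 1 and t = "a * x"]) auto
    qed
    also have "\<dots> = (\<integral>\<^sup>+x. (\<integral>\<^sup>+w. ennreal (m x) * ennreal (n (w - a * x)) * indicator A w \<partial>lborel) \<partial>lborel)"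
      by (simp add: nn_integral_cmult[symmetric] mult.assoc)
    also have "\<dots> = (\<integral>\<^sup>+w. (\<integral>\<^sup>+x. ennreal (m x) * ennreal (n (w - a * x)) * indicator A w \<partial>lborel) \<partial>lborel)"
      by (rule lborel_pair.Fubini') simp
    also have "\<dots> = (\<integral>\<^sup>+w. ennreal (q w) * indicator A w \<partial>lborel)"
      by (simp add: q nn_integral_multc)
    also have "\<dots> = emeasure (density lborel q) A"
      by (simp add: emeasure_density)
    finally show ?thesis .
  qed
  show "prob_space (density lborel q)"
    by standard (use K[of UNIV] m.emeasure_space_1 n.emeasure_space_1 in simp)
  then interpret q: prob_space "density lborel q" .
  interpret Q: product_prob_space "\<lambda>_. density lborel q" I ..
  show "?L = ?R"
  proof (rule Q.PiM_eqI[OF \<open>finite I\<close>])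
    show "sets ?L = sets ?R" by (simp, rule sets_PiM_cong) auto
    fix A :: "_ \<Rightarrow> real set"
    assume "\<And>i. i \<in> I \<Longrightarrow> A i \<in> sets (density lborel q)"
    then have A [measurable]: "A i \<in> sets borel" if "i \<in> I" for i
      using that by simp
    have [measurable]: "Pi\<^sub>E I A \<in> sets (Pi\<^sub>M I (\<lambda>_. lborel))"
      using A \<open>finite I\<close> by (intro sets_PiM_I_finite) auto
    have [measurable]: "(\<lambda>(x, y). \<lambda>i\<in>I. a * x i + y i) \<in>
      Pi\<^sub>M I (\<lambda>_. density lborel m) \<Otimes>\<^sub>M Pi\<^sub>M I (\<lambda>_. density lborel n) \<rightarrow>\<^sub>M Pi\<^sub>M I (\<lambda>_. lborel)"
      by measurable
    have "emeasure ?L (Pi\<^sub>E I A) = (\<integral>\<^sup>+w. indicator (Pi\<^sub>E I A) w \<partial>?L)"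
      by simp
    also have "\<dots> = (\<integral>\<^sup>+x. (\<integral>\<^sup>+y. indicator (Pi\<^sub>E I A) (\<lambda>i\<in>I. a * x i + y i)
       \<partial>Pi\<^sub>M I (\<lambda>_. density lborel n)) \<partial>Pi\<^sub>M I (\<lambda>_. density lborel m))"
      by (subst nn_integral_distr, measurable, subst N.nn_integral_fst[symmetric]) (simp_all add: split_beta')
    also have "\<dots> = (\<integral>\<^sup>+x. (\<integral>\<^sup>+y. (\<Prod>i\<in>I. indicator (A i) (a * x i + y i))
       \<partial>Pi\<^sub>M I (\<lambda>_. density lborel n)) \<partial>Pi\<^sub>M I (\<lambda>_. density lborel m))"
      using \<open>finite I\<close>
      by (intro nn_integral_cong)
         (auto simp: space_PiM PiE_iff indicator_def prod_zero_iff split: if_splits)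
    also have "\<dots> = (\<integral>\<^sup>+x. (\<Prod>i\<in>I. \<integral>\<^sup>+y. indicator (A i) (a * x i + y)
       \<partial>density lborel n) \<partial>Pi\<^sub>M I (\<lambda>_. density lborel m))"
      by (intro nn_integral_cong N.product_nn_integral_prod \<open>finite I\<close>) measurable
    also have "\<dots> = (\<Prod>i\<in>I. \<integral>\<^sup>+x. \<integral>\<^sup>+y. indicator (A i) (a * x + y) \<partial>density lborel n \<partial>density lborel m)"
      by (intro P.product_nn_integral_prod \<open>finite I\<close>) measurable
    also have "\<dots> = (\<Prod>i\<in>I. emeasure (density lborel q) (A i))"
      by (intro prod.cong refl K A)
    finally show "emeasure ?L (Pi\<^sub>E I A) = (\<Prod>i\<in>I. emeasure (density lborel q) (A i))" .
  qed
qed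

subsection \<open>Laplace transforms\<close>

text \<open>The tangent inequality at \<open>- u\<close> gives
  \<open>exp u - 1 \<le> u * exp u\<close>. Estimating the factor \<open>exp u\<close> on the right
  once more, from above for \<open>u \<ge> 0\<close> and from below for \<open>u < 0\<close>, gains
  the second power of \<open>u\<close>.\<close>

lemma exp_second_order_bound:
  fixes u :: real
  shows "\<bar>exp u - 1 - u\<bar> \<le> u\<^sup>2 * exp \<bar>u\<bar>"
proof -
  have 1: "exp u - 1 - u \<ge> 0" using exp_ge_add_one_self[of u] by linarith
  have "(1 - u) * exp u \<le> exp (- u) * exp u"
    using exp_ge_add_one_self[of "- u"] by (intro mult_right_mono) auto
  then have "exp u - 1 \<le> u * exp u" by (simp add: algebra_simps flip: exp_add)
  show ?thesis
  proof (cases "u \<ge> 0")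
    case True
    have "u * (1 + u * exp u) \<ge> u * exp u"
      using True \<open>exp u - 1 \<le> u * exp u\<close> by (intro mult_left_mono) auto
    then show ?thesis using 1 True \<open>exp u - 1 \<le> u * exp u\<close>
      by (simp add: power2_eq_square algebra_simps)
  next
    case False
    have "u * exp u \<le> u * (1 + u)"
      using False exp_ge_add_one_self[of u] by (intro mult_left_mono_neg) auto
    moreover have "u\<^sup>2 * 1 \<le> u\<^sup>2 * exp \<bar>u\<bar>" by (intro mult_left_mono) auto
    ultimately show ?thesis using 1 \<open>exp u - 1 \<le> u * exp u\<close>
      by (simp add: power2_eq_square algebra_simps)
  qed
qed

text \<open>All exponential moments are required, with \<open>\<bar>z\<bar>\<close> in the exponent
  so that both signs of the Laplace variable are covered. The class is closed under multiplication
  by \<open>z\<close>, because \<open>\<bar>z\<bar> \<le> exp \<bar>z\<bar>\<close> merely raises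
  \<open>r\<close> by 1; Laplace transforms can thus be differentiated repeatedly.\<close>

definition exp_integrable :: "(real \<Rightarrow> real) \<Rightarrow> bool" where
  "exp_integrable V \<longleftrightarrow> V \<in> borel_measurable borel \<and> (\<forall>r. integrable lborel (\<lambda>z. V z * exp (r * \<bar>z\<bar>)))"

lemma exp_integrable_times:
  assumes "exp_integrable V"
  shows "exp_integrable (\<lambda>z. z * V z)"
  unfolding exp_integrable_def
proof (intro conjI allI)
  have [measurable]: "V \<in> borel_measurable borel" using assms by (simp add: exp_integrable_def)
  show "(\<lambda>z. z * V z) \<in> borel_measurable borel" by measurable
  fix r
  have "integrable lborel (\<lambda>z. V z * exp ((r + 1) * \<bar>z\<bar>))"
    using assms by (simp only: exp_integrable_def)
  then show "integrable lborel (\<lambda>z. z * V z * exp (r * \<bar>z\<bar>))"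
  proof (rule Bochner_Integration.integrable_bound)
    have "norm (z * V z * exp (r * \<bar>z\<bar>)) \<le> norm (V z * exp ((r + 1) * \<bar>z\<bar>))" for z
    proof -
      have "\<bar>z\<bar> \<le> exp \<bar>z\<bar>" using exp_ge_add_one_self[of "\<bar>z\<bar>"] by linarith
      then have "\<bar>z\<bar> * (\<bar>V z\<bar> * exp (r * \<bar>z\<bar>)) \<le> exp \<bar>z\<bar> * (\<bar>V z\<bar> * exp (r * \<bar>z\<bar>))"
        by (intro mult_right_mono) auto
      then show ?thesis by (simp add: abs_mult exp_add algebra_simps)
    qed
    then show "AE z in lborel. norm (z * V z * exp (r * \<bar>z\<bar>)) \<le> norm (V z * exp ((r + 1) * \<bar>z\<bar>))"
      by simp
  qed simp
qed

lemma exp_integrable_integrable: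
  assumes "exp_integrable V"
  shows "integrable lborel (\<lambda>z. V z * exp (y * z))"
proof -
  have [measurable]: "V \<in> borel_measurable borel" using assms by (simp add: exp_integrable_def)
  have "integrable lborel (\<lambda>z. V z * exp (\<bar>y\<bar> * \<bar>z\<bar>))"
    using assms by (simp add: exp_integrable_def)
  then show ?thesis
  proof (rule Bochner_Integration.integrable_bound)
    have "norm (V z * exp (y * z)) \<le> norm (V z * exp (\<bar>y\<bar> * \<bar>z\<bar>))" for z
    proof -
      have "y * z \<le> \<bar>y\<bar> * \<bar>z\<bar>" by (simp flip: abs_mult)
      then show ?thesis by (simp add: abs_mult mult_left_mono)
    qed
    then show "AE z in lborel. norm (V z * exp (y * z)) \<le> norm (V z * exp (\<bar>y\<bar> * \<bar>z\<bar>))"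
      by simp
  qed simp
qed

lemma laplace_transform_has_derivative:
  assumes V: "exp_integrable V"
  shows "((\<lambda>y. \<integral>z. V z * exp (y * z) \<partial>lborel) has_real_derivative
           (\<integral>z. z * V z * exp (y * z) \<partial>lborel)) (at y)"
proof -
  let ?F = "\<lambda>y. \<integral>z. V z * exp (y * z) \<partial>lborel"
  let ?F' = "\<integral>z. z * V z * exp (y * z) \<partial>lborel"
  have [measurable]: "V \<in> borel_measurable borel" using assms by (simp add: exp_integrable_def)
  \<comment> \<open>\<open>B\<close> dominates the second-order remainder for all
    \<open>\<bar>h\<bar> \<le> 1\<close> at once; the extra 1 in the exponent absorbs
    \<open>exp \<bar>h * z\<bar>\<close>.\<close>
  define B where "B z = \<bar>z * (z * V z) * exp ((\<bar>y\<bar> + 1) * \<bar>z\<bar>)\<bar>" for z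
  have B: "integrable lborel B"
    using exp_integrable_times[OF exp_integrable_times[OF V]]
    unfolding B_def by (intro integrable_abs) (simp add: exp_integrable_def)
  define K where "K = (\<integral>z. B z \<partial>lborel)"
  have bound: "\<bar>?F (y + h) - ?F y - h * ?F'\<bar> \<le> h\<^sup>2 * K" if h: "\<bar>h\<bar> \<le> 1" for h
  proof -
    note I = exp_integrable_integrable[OF V] exp_integrable_integrable[OF exp_integrable_times[OF V]]
    have "?F (y + h) - ?F y - h * ?F' =
        (\<integral>z. V z * exp ((y + h) * z) - V z * exp (y * z) - h * (z * V z * exp (y * z)) \<partial>lborel)"
      using I(1)[of "y + h"] I(1)[of y] I(2)[of y] by simp
    also have "\<bar>\<dots>\<bar> \<le> (\<integral>z. h\<^sup>2 * B z \<partial>lborel)"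
    proof (rule integral_abs_bound_integral)
      show "integrable lborel (\<lambda>z. V z * exp ((y + h) * z) - V z * exp (y * z) - h * (z * V z * exp (y * z)))"
        using I(1)[of "y + h"] I(1)[of y] I(2)[of y] by simp
      show "integrable lborel (\<lambda>z. h\<^sup>2 * B z)" using B by simp
      fix z
      have "V z * exp ((y + h) * z) - V z * exp (y * z) - h * (z * V z * exp (y * z))
          = V z * exp (y * z) * (exp (h * z) - 1 - h * z)"
        by (simp add: algebra_simps exp_add)
      also have "\<bar>\<dots>\<bar> \<le> \<bar>V z\<bar> * exp (\<bar>y\<bar> * \<bar>z\<bar>) * ((h * z)\<^sup>2 * exp \<bar>z\<bar>)"
      proof -
        have "\<bar>exp (h * z) - 1 - h * z\<bar> \<le> (h * z)\<^sup>2 * exp \<bar>h * z\<bar>" by (rule exp_second_order_bound)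
        also have "\<dots> \<le> (h * z)\<^sup>2 * exp \<bar>z\<bar>"
          using h by (intro mult_left_mono) (auto simp: abs_mult mult_left_le_one_le)
        finally have "\<bar>exp (h * z) - 1 - h * z\<bar> \<le> (h * z)\<^sup>2 * exp \<bar>z\<bar>" .
        moreover have "exp (y * z) \<le> exp (\<bar>y\<bar> * \<bar>z\<bar>)" by (simp flip: abs_mult)
        ultimately show ?thesis
          unfolding abs_mult by (intro mult_mono) auto
      qed
      also have "\<dots> = h\<^sup>2 * B z"
        by (simp add: B_def abs_mult power2_eq_square exp_add algebra_simps)
      finally show "\<bar>V z * exp ((y + h) * z) - V z * exp (y * z) - h * (z * V z * exp (y * z))\<bar> \<le> h\<^sup>2 * B z" .
    qed
    finally show ?thesis by (simp add: K_def)
  qed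
  have "(\<lambda>h. (?F (y + h) - ?F y) / h - ?F') \<midarrow>0\<rightarrow> 0"
  proof (rule Lim_null_comparison)
    show "((\<lambda>h. \<bar>h\<bar> * K) \<longlongrightarrow> 0) (at 0)" by (auto intro!: tendsto_eq_intros)
    have "eventually (\<lambda>h::real. \<bar>h\<bar> < 1) (at 0)"
      by (rule eventually_at_topological[THEN iffD2])
         (auto intro!: exI[of _ "{-1<..<1}"])
    moreover have "eventually (\<lambda>h::real. h \<noteq> 0) (at 0)" by (simp add: eventually_at_filter)
    ultimately show "eventually (\<lambda>h. norm ((?F (y + h) - ?F y) / h - ?F') \<le> \<bar>h\<bar> * K) (at 0)"
    proof eventually_elim
      case (elim h)
      have "norm ((?F (y + h) - ?F y) / h - ?F') = \<bar>?F (y + h) - ?F y - h * ?F'\<bar> / \<bar>h\<bar>"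
        using elim(2) by (simp add: diff_divide_distrib flip: abs_divide)
      also have "\<dots> \<le> (h\<^sup>2 * K) / \<bar>h\<bar>" using bound[of h] elim(1) by (intro divide_right_mono) auto
      also have "\<dots> = \<bar>h\<bar> * K" using elim(2) by (simp add: power2_eq_square abs_if field_simps)
      finally show ?case .
    qed
  qed
  then show ?thesis
    unfolding DERIV_def by (simp add: LIM_zero_iff)
qed

lemma exp_integrable_gaussian_bound:
  assumes [measurable]: "W \<in> borel_measurable borel"
    and W: "\<And>z. \<bar>W z\<bar> \<le> C * exp (- z\<^sup>2 / 2)"
  shows "exp_integrable W"
  unfolding exp_integrable_def
proof (intro conjI allI)
  fix r
  \<comment> \<open>Since \<open>r * \<bar>z\<bar> \<le> z\<^sup>2 / 4 + r\<^sup>2\<close>, half of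
    the Gaussian exponent survives. What remains is a multiple of the normal density of variance 2,
    whose normalisation is \<open>sqrt (4 * pi)\<close>.\<close>
  have "integrable lborel (\<lambda>z. (C * exp (r\<^sup>2) * (sqrt (4 * pi))) * normal_density 0 (sqrt 2) z)"
    by (intro integrable_mult_right integrable_normal_density) simp
  then show "integrable lborel (\<lambda>z. W z * exp (r * \<bar>z\<bar>))"
  proof (rule Bochner_Integration.integrable_bound)
    have "norm (W z * exp (r * \<bar>z\<bar>)) \<le> norm ((C * exp (r\<^sup>2) * (sqrt (4 * pi))) * normal_density 0 (sqrt 2) z)" for z
    proof -
      have C: "C \<ge> 0" using W[of 0] by simp
      have "r * \<bar>z\<bar> \<le> z\<^sup>2 / 4 + r\<^sup>2"
        using zero_le_power2[of "\<bar>z\<bar> / 2 - r"] by (simp add: power2_diff power_divide mult.commute)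
      then have "exp (- z\<^sup>2 / 2) * exp (r * \<bar>z\<bar>) \<le> exp (r\<^sup>2) * exp (- z\<^sup>2 / 4)"
        by (simp flip: exp_add)
      then have "C * exp (- z\<^sup>2 / 2) * exp (r * \<bar>z\<bar>) \<le> C * (exp (r\<^sup>2) * exp (- z\<^sup>2 / 4))"
        using C by (simp add: mult.assoc mult_left_mono)
      moreover have "\<bar>W z\<bar> * exp (r * \<bar>z\<bar>) \<le> C * exp (- z\<^sup>2 / 2) * exp (r * \<bar>z\<bar>)"
        using W by (intro mult_right_mono) auto
      ultimately have "\<bar>W z\<bar> * exp (r * \<bar>z\<bar>) \<le> C * (exp (r\<^sup>2) * exp (- z\<^sup>2 / 4))"
        by linarith
      then show ?thesis using C by (simp add: normal_density_def abs_mult)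
    qed
    then show "AE z in lborel. norm (W z * exp (r * \<bar>z\<bar>))
        \<le> norm ((C * exp (r\<^sup>2) * (sqrt (4 * pi))) * normal_density 0 (sqrt 2) z)"
      by simp
  qed simp
qed simp

subsection \<open>The double-well potential\<close>

lemma integral_pos_real:
  assumes "integrable lborel f" "\<And>z::real. f z > (0::real)"
  shows "(\<integral>z. f z \<partial>lborel) > 0"
proof -
  have "(\<integral>z. f z \<partial>lborel) \<noteq> 0"
  proof
    assume "(\<integral>z. f z \<partial>lborel) = 0"
    then have "AE z in lborel. f z = 0"
      using assms(2) by (subst (asm) integral_nonneg_eq_0_iff_AE[OF assms(1)]) (auto intro: less_imp_le)
    then have "AE z in (lborel :: real measure). False"
      by eventually_elim (use assms(2) in \<open>simp add: less_le\<close>)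
    then show False by (simp add: eventually_False ae_filter_eq_bot_iff)
  qed
  moreover have "(\<integral>z. f z \<partial>lborel) \<ge> 0"
    using assms(2) by (intro Bochner_Integration.integral_nonneg) (auto intro: less_imp_le)
  ultimately show ?thesis by simp
qed

lemma integral_odd_eq_0:
  fixes f :: "real \<Rightarrow> real"
  assumes "\<And>z. f (- z) = - f z"
  shows "(\<integral>z. f z \<partial>lborel) = 0"
  using lborel_integral_real_affine[of "-1" f 0] assms by simp

lemma integral_derivative_eq_0:
  fixes F :: "real \<Rightarrow> real"
  assumes "\<And>x. (F has_real_derivative f x) (at x)" "\<And>x. isCont f x" "integrable lborel f"
    and "(F \<longlongrightarrow> 0) at_bot" "(F \<longlongrightarrow> 0) at_top"
  shows "(\<integral>x. f x \<partial>lborel) = 0"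
proof -
  have UNIV: "einterval (- \<infinity>) \<infinity> = UNIV" by (simp add: einterval_eq)
  have "(LBINT x=-\<infinity>..\<infinity>. f x) = 0 - 0"
  proof (rule interval_integral_FTC_integrable[where F = F])
    show "set_integrable lborel (einterval (- \<infinity>) \<infinity>) f"
      using assms(3) by (simp add: UNIV set_integrable_def)
    show "((F \<circ> real_of_ereal) \<longlongrightarrow> 0) (at_right (- \<infinity>))"
      "((F \<circ> real_of_ereal) \<longlongrightarrow> 0) (at_left \<infinity>)"
      using assms(4,5) by (simp_all add: ereal_tendsto_simps1)
  qed (use assms(1,2) in \<open>auto simp: has_real_derivative_iff_has_vector_derivative\<close>)
  then show ?thesis
    by (simp add: interval_lebesgue_integral_def UNIV set_lebesgue_integral_def)
qed

text \<open>This is \<open>k * phi (z / sqrt k)\<close> for the fixed double well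
  \<open>phi y = y\<^sup>2 / 2 + 2 * cos y\<close>. The scaling keeps the second derivative in
  \<open>[-1, 3]\<close> for every \<open>k\<close> while it moves the wells apart like
  \<open>sqrt k\<close>.\<close>

definition well :: "real \<Rightarrow> real \<Rightarrow> real" where
  "well k z = z\<^sup>2 / 2 + 2 * k * cos (z / sqrt k)"

lemma well_has_derivative:
  assumes "k > 0"
  shows "(well k has_real_derivative z - 2 * sqrt k * sin (z / sqrt k)) (at z)"
proof -
  have "2 * k / sqrt k = 2 * sqrt k" using assms by (simp add: real_div_sqrt flip: times_divide_eq_right)
  then show ?thesis
    unfolding well_def using assms by (auto intro!: derivative_eq_intros simp: field_simps)
qed

lemma abs_sin_diff_le: "\<bar>sin x - sin y\<bar> \<le> \<bar>x - y :: real\<bar>"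
proof -
  have "\<bar>sin x - sin y\<bar> = 2 * (\<bar>sin ((x - y) / 2)\<bar> * \<bar>cos ((x + y) / 2)\<bar>)"
    by (simp add: sin_diff_sin abs_mult)
  also have "\<dots> \<le> 2 * (\<bar>(x - y) / 2\<bar> * 1)"
    by (intro mult_left_mono mult_mono abs_sin_x_le_abs_x) auto
  finally show ?thesis by simp
qed

lemma cos_ge_1_minus_half_square: "cos x \<ge> 1 - x\<^sup>2 / 2" for x :: real
proof -
  have "(sin (x / 2))\<^sup>2 \<le> (x / 2)\<^sup>2"
    using abs_sin_x_le_abs_x[of "x / 2"] by (simp only: abs_le_square_iff)
  then show ?thesis using cos_double_sin[of "x / 2"] by (simp add: power_divide)
qed

text \<open>The amplitude \<open>2 * sqrt k\<close> cancels against the frequency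
  \<open>1 / sqrt k\<close>, which leaves \<open>1 + 2 = 3\<close>.\<close>

lemma well_deriv_lipschitz:
  assumes "k > 0"
  shows "\<bar>(x - 2 * sqrt k * sin (x / sqrt k)) - (y - 2 * sqrt k * sin (y / sqrt k))\<bar> \<le> 3 * \<bar>x - y\<bar>"
proof -
  have "2 * sqrt k * \<bar>sin (x / sqrt k) - sin (y / sqrt k)\<bar> \<le> 2 * sqrt k * \<bar>x / sqrt k - y / sqrt k\<bar>"
    using assms by (intro mult_left_mono abs_sin_diff_le) auto
  also have "\<dots> = 2 * \<bar>x - y\<bar>"
    using assms by (simp add: diff_divide_distrib[symmetric])
  finally have *: "2 * sqrt k * \<bar>sin (x / sqrt k) - sin (y / sqrt k)\<bar> \<le> 2 * \<bar>x - y\<bar>" .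
  define P Q where "P = x - y" and "Q = 2 * sqrt k * sin (x / sqrt k) - 2 * sqrt k * sin (y / sqrt k)"
  have QP: "\<bar>Q\<bar> \<le> 2 * \<bar>P\<bar>"
    using * assms by (simp add: P_def Q_def abs_mult flip: right_diff_distrib)
  have "\<bar>P - Q\<bar> \<le> 3 * \<bar>P\<bar>"
    using QP by linarith
  then show ?thesis by (simp add: P_def Q_def algebra_simps)
qed

text \<open>The cosine term costs at most a factor \<open>exp (2 * k)\<close> over a Gaussian, and
  the extra quadratic only helps. The case \<open>l = 0\<close> serves the initial law, the general
  case the tilted one.\<close>

lemma well_exp_integrable:
  assumes "k > 0" "l \<ge> 0"
  shows "exp_integrable (\<lambda>z. exp (- well k z - l * z\<^sup>2 / 2))"
proof (rule exp_integrable_gaussian_bound)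
  show "(\<lambda>z. exp (- well k z - l * z\<^sup>2 / 2)) \<in> borel_measurable borel"
    unfolding well_def by measurable
  fix z
  have "2 * k * cos (z / sqrt k) \<ge> 2 * k * (-1)"
    using assms by (intro mult_left_mono) auto
  moreover have "l * z\<^sup>2 / 2 \<ge> 0" using assms by simp
  ultimately have "- well k z - l * z\<^sup>2 / 2 \<le> 2 * k + - z\<^sup>2 / 2"
    unfolding well_def by linarith
  then show "\<bar>exp (- well k z - l * z\<^sup>2 / 2)\<bar> \<le> exp (2 * k) * exp (- z\<^sup>2 / 2)"
    by (simp flip: exp_add)
qed

text \<open>With \<open>h = well k z + l z\<^sup>2 / 2\<close>, integrating \<open>(e\<^sup>-\<^sup>h)'' = (h'\<^sup>2 - h'') e\<^sup>-\<^sup>h\<close> shows that \<open>h''\<close> has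
  nonnegative mean, and \<open>h'' \<le> l - 1 + z\<^sup>2 / k\<close>.\<close>

lemma well_second_moment:
  assumes "k > 0" "l \<ge> 0"
  defines "W \<equiv> \<lambda>z. exp (- well k z - l * z\<^sup>2 / 2)"
  shows "(1 - l) * k * (\<integral>z. W z \<partial>lborel) \<le> (\<integral>z. z * (z * W z) \<partial>lborel)"
proof -
  define h' where "h' z = (1 + l) * z - 2 * sqrt k * sin (z / sqrt k)" for z
  define h'' where "h'' z = 1 + l - 2 * cos (z / sqrt k)" for z
  \<comment> \<open>\<open>F\<close> is the first and \<open>f\<close> the second derivative of
    \<open>W\<close>, so \<open>f\<close> integrates to 0 once \<open>F\<close> vanishes at both
    ends.\<close>
  define F where "F z = - h' z * W z" for z
  define f where "f z = (h' z ^ 2 - h'' z) * W z" for z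
  have W: "exp_integrable W" unfolding W_def using assms by (intro well_exp_integrable)
  have [measurable]: "W \<in> borel_measurable borel" using W by (simp add: exp_integrable_def)
  have IW: "integrable lborel W" "integrable lborel (\<lambda>z. z * (z * W z))"
    using exp_integrable_integrable[OF W, of 0]
      exp_integrable_integrable[OF exp_integrable_times[OF exp_integrable_times[OF W]], of 0] by simp_all
  have W_pos: "W z > 0" for z by (simp add: W_def)
  have dW: "(W has_real_derivative - h' z * W z) (at z)" for z
    unfolding W_def h'_def
    by (auto intro!: derivative_eq_intros well_has_derivative assms simp: algebra_simps)
  have dh': "(h' has_real_derivative h'' z) (at z)" for z
  proof -
    define c where "c = sqrt k"
    have "c \<noteq> 0" using assms(1) by (simp add: c_def)
    then have "((\<lambda>z. (1 + l) * z - 2 * c * sin (z / c)) has_real_derivative 1 + l - 2 * cos (z / c)) (at z)"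
      by (auto intro!: derivative_eq_intros)
    then show ?thesis by (simp add: h'_def[abs_def] h''_def c_def)
  qed
  have dF: "(F has_real_derivative f z) (at z)" for z
    unfolding F_def f_def
    by (auto intro!: derivative_eq_intros dW dh' simp: algebra_simps power2_eq_square)
  have h'_le: "\<bar>h' z\<bar> \<le> (3 + l) * \<bar>z\<bar>" for z
  proof -
    have "\<bar>z - 2 * sqrt k * sin (z / sqrt k)\<bar> \<le> 3 * \<bar>z\<bar>"
      using well_deriv_lipschitz[OF assms(1), of z 0] by simp
    moreover have "\<bar>l * z\<bar> = l * \<bar>z\<bar>" using assms by (simp add: abs_mult)
    ultimately show ?thesis unfolding h'_def by (simp add: algebra_simps)
  qed
  have h''_le: "\<bar>h'' z\<bar> \<le> 3 + l" for z
    unfolding h''_def using assms cos_ge_minus_one[of "z / sqrt k"] cos_le_one[of "z / sqrt k"] by linarith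
  have f_int: "integrable lborel f"
  proof (rule Bochner_Integration.integrable_bound)
    show "integrable lborel (\<lambda>z. (3 + l)\<^sup>2 * (z * (z * W z)) + (3 + l) * W z)"
      using IW by simp
    show "f \<in> borel_measurable lborel"
      unfolding f_def h'_def h''_def by measurable
    have "norm (f z) \<le> norm ((3 + l)\<^sup>2 * (z * (z * W z)) + (3 + l) * W z)" for z
    proof -
      have "(h' z)\<^sup>2 \<le> ((3 + l) * \<bar>z\<bar>)\<^sup>2"
        using h'_le[of z] by (subst power2_abs[symmetric]) (intro power_mono, auto)
      then have "\<bar>h' z ^ 2 - h'' z\<bar> \<le> (3 + l)\<^sup>2 * z\<^sup>2 + (3 + l)"
        using h''_le[of z] zero_le_power2[of "h' z"] unfolding power_mult_distrib power2_abs by linarith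
      then have "\<bar>h' z ^ 2 - h'' z\<bar> * W z \<le> ((3 + l)\<^sup>2 * z\<^sup>2 + (3 + l)) * W z"
        using W_pos[of z] by (intro mult_right_mono) auto
      also have "\<dots> = (3 + l)\<^sup>2 * (z * (z * W z)) + (3 + l) * W z"
        by (simp add: algebra_simps power2_eq_square)
      finally show ?thesis using W_pos[of z] by (simp add: f_def abs_mult)
    qed
    then show "AE z in lborel. norm (f z) \<le> norm ((3 + l)\<^sup>2 * (z * (z * W z)) + (3 + l) * W z)"
      by simp
  qed
  \<comment> \<open>Linear growth of \<open>h'\<close> against Gaussian decay of \<open>W\<close>
    makes the boundary terms vanish.\<close>
  have F_le: "norm (F z) \<le> (3 + l) * exp (2 * k) * (\<bar>z\<bar> * exp (- z\<^sup>2 / 2))" for z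
  proof -
    have "2 * k * cos (z / sqrt k) \<ge> 2 * k * (-1)"
      using assms by (intro mult_left_mono) auto
    moreover have "l * z\<^sup>2 / 2 \<ge> 0" using assms by simp
    ultimately have "- well k z - l * z\<^sup>2 / 2 \<le> 2 * k + - z\<^sup>2 / 2"
      unfolding well_def by linarith
    then have "W z \<le> exp (2 * k) * exp (- z\<^sup>2 / 2)"
      by (simp add: W_def flip: exp_add)
    then have "\<bar>h' z\<bar> * W z \<le> ((3 + l) * \<bar>z\<bar>) * (exp (2 * k) * exp (- z\<^sup>2 / 2))"
      using h'_le[of z] W_pos[of z] assms by (intro mult_mono) auto
    then show ?thesis using W_pos[of z] by (simp add: F_def abs_mult algebra_simps)
  qed
  have "(\<integral>z. f z \<partial>lborel) = 0"
  proof (rule integral_derivative_eq_0[OF dF _ f_int])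
    show "isCont f z" for z
      unfolding f_def h'_def h''_def using dW[THEN DERIV_isCont] assms
      by (auto intro!: continuous_intros)
    have "((\<lambda>z. (3 + l) * exp (2 * k) * (\<bar>z\<bar> * exp (- z\<^sup>2 / 2))) \<longlongrightarrow> (3 + l) * exp (2 * k) * 0) at_top"
      by (intro tendsto_mult tendsto_const) real_asymp
    then show "(F \<longlongrightarrow> 0) at_top"
      by (intro Lim_null_comparison[where f = F, OF always_eventually[OF allI[OF F_le]]]) simp
    have "((\<lambda>z. (3 + l) * exp (2 * k) * (\<bar>z\<bar> * exp (- z\<^sup>2 / 2))) \<longlongrightarrow> (3 + l) * exp (2 * k) * 0) at_bot"
      by (intro tendsto_mult tendsto_const) real_asymp
    then show "(F \<longlongrightarrow> 0) at_bot"
      by (intro Lim_null_comparison[where f = F, OF always_eventually[OF allI[OF F_le]]]) simp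
  qed
  moreover have "(\<integral>z. f z \<partial>lborel) \<ge> (\<integral>z. (1 - l) * W z - (1 / k) * (z * (z * W z)) \<partial>lborel)"
  proof (rule integral_mono[OF _ f_int])
    show "integrable lborel (\<lambda>z. (1 - l) * W z - (1 / k) * (z * (z * W z)))"
      using IW by (intro Bochner_Integration.integrable_diff integrable_mult_right)
    fix z
    have "cos (z / sqrt k) \<ge> 1 - (z / sqrt k)\<^sup>2 / 2" by (rule cos_ge_1_minus_half_square)
    then have "h'' z \<le> l - 1 + z\<^sup>2 / k" using assms by (simp add: h''_def power_divide)
    then have "(1 - l) - z\<^sup>2 / k \<le> h' z ^ 2 - h'' z"
      using zero_le_power2[of "h' z"] by linarith
    then have "((1 - l) - z\<^sup>2 / k) * W z \<le> (h' z ^ 2 - h'' z) * W z"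
      using W_pos[of z] by (intro mult_right_mono) auto
    then show "(1 - l) * W z - (1 / k) * (z * (z * W z)) \<le> f z"
      by (simp add: f_def algebra_simps power2_eq_square)
  qed
  ultimately have "(1 - l) * (\<integral>z. W z \<partial>lborel) \<le> (1 / k) * (\<integral>z. z * (z * W z) \<partial>lborel)"
    using IW by simp
  then show ?thesis using assms by (simp add: field_simps)
qed

section \<open>Smoothing the double well by a Gaussian\<close>

text \<open>Expanding the square in the Gaussian kernel separates it into a factor in
  \<open>x\<close>, a factor \<open>exp (- l * z\<^sup>2 / 2)\<close> that tilts the potential, and
  \<open>exp (b * x * z)\<close>. Hence \<open>ln q\<close> is a quadratic plus the log-Laplace
  transform of \<open>W\<close> at \<open>b * x\<close>, whose second derivative is
  \<open>b\<^sup>2\<close> times a variance. The law weighted in this way is that of the starting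
  coordinate conditioned on the final one being \<open>x\<close>.\<close>

lemma diffused_well:
  fixes k a :: real
  assumes "k > 0" "a > 0" "a\<^sup>2 \<le> 1 / 10"
  obtains q u' u'' where
    "\<And>x. q x > 0" "q \<in> borel_measurable borel"
    "\<And>x. ennreal (q x) = (\<integral>\<^sup>+z. ennreal (exp (- well k z) / (\<integral>w. exp (- well k w) \<partial>lborel))
       * ennreal (normal_density 0 (sqrt (1 - a\<^sup>2)) (x - a * z)) \<partial>lborel)"
    "\<And>x. ((\<lambda>x. ln (q x)) has_real_derivative u' x) (at x)"
    "\<And>x. (u' has_real_derivative u'' x) (at x)"
    "\<bar>u'' 0\<bar> \<ge> a\<^sup>2 * k / 2 - 1"
proof -
  define v where "v = 1 - a\<^sup>2"
  have v: "v > 0" "v \<le> 1" "v \<ge> 9 / 10" using assms by (auto simp: v_def)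
  \<comment> \<open>From \<open>a\<^sup>2 \<le> 1 / 10\<close> one gets
    \<open>l \<le> 1 / 9\<close>; the weaker \<open>l \<le> 1 / 2\<close> is enough for
    \<open>1 - l \<ge> 1 / 2\<close>.\<close>
  define l where "l = a\<^sup>2 / v"
  have l: "l \<ge> 0" "l \<le> 1 / 2" using v assms by (auto simp: l_def divide_simps v_def)
  define b where "b = a / v"
  define Z where "Z = (\<integral>w. exp (- well k w) \<partial>lborel)"
  define W where "W z = exp (- well k z - l * z\<^sup>2 / 2)" for z
  define C where "C = 1 / (Z * sqrt (2 * pi * v))"
  have "exp_integrable (\<lambda>z. exp (- well k z - 0 * z\<^sup>2 / 2))"
    using assms by (intro well_exp_integrable) auto
  from exp_integrable_integrable[OF this, of 0] have "Z > 0"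
    unfolding Z_def by (intro integral_pos_real) auto
  then have C: "C > 0" using v by (simp add: C_def)
  have W: "exp_integrable W" unfolding W_def using assms l by (intro well_exp_integrable) auto
  note W1 = exp_integrable_times[OF W] and IW = exp_integrable_integrable[OF W]
  define F0 where "F0 y = (\<integral>z. W z * exp (y * z) \<partial>lborel)" for y
  define F1 where "F1 y = (\<integral>z. z * W z * exp (y * z) \<partial>lborel)" for y
  define F2 where "F2 y = (\<integral>z. z * (z * W z) * exp (y * z) \<partial>lborel)" for y
  have F0: "F0 y > 0" for y
    unfolding F0_def by (rule integral_pos_real[OF IW]) (simp add: W_def)
  have d0: "(F0 has_real_derivative F1 y) (at y)" for y
    unfolding F0_def[abs_def] F1_def by (rule laplace_transform_has_derivative[OF W])
  have d1: "(F1 has_real_derivative F2 y) (at y)" for y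
    unfolding F1_def[abs_def] F2_def by (rule laplace_transform_has_derivative[OF W1])
  note d0' = DERIV_chain2[OF d0] and d1' = DERIV_chain2[OF d1]
  define q where "q x = C * exp (- x\<^sup>2 / (2 * v)) * F0 (b * x)" for x
  define u' where "u' x = - x / v + b * F1 (b * x) / F0 (b * x)" for x
  define u'' where "u'' x = - 1 / v + b\<^sup>2 * (F2 (b * x) * F0 (b * x) - F1 (b * x) * F1 (b * x)) / (F0 (b * x))\<^sup>2" for x
  show ?thesis
  proof (rule that[of q u' u''])
    show "q x > 0" for x using C F0 by (simp add: q_def)
    have "continuous_on UNIV F0"
      using d0 by (meson DERIV_isCont continuous_at_imp_continuous_on)
    then have [measurable]: "F0 \<in> borel_measurable borel"
      by (rule borel_measurable_continuous_onI)
    show "q \<in> borel_measurable borel"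
      unfolding q_def by measurable
    have ln_q: "ln (q x) = ln C - x\<^sup>2 / (2 * v) + ln (F0 (b * x))" for x
      using C F0[of "b * x"] by (simp add: q_def ln_mult)
    show "((\<lambda>x. ln (q x)) has_real_derivative u' x) (at x)" for x
      unfolding ln_q u'_def using v F0[of "b * x"]
      by (auto intro!: derivative_eq_intros d0' simp: field_simps)
    show "(u' has_real_derivative u'' x) (at x)" for x
      unfolding u'_def[abs_def] u''_def using v F0[of "b * x"]
      by (auto intro!: derivative_eq_intros d0' d1' simp: field_simps power2_eq_square)
    show "ennreal (q x) = (\<integral>\<^sup>+z. ennreal (exp (- well k z) / (\<integral>w. exp (- well k w) \<partial>lborel))
       * ennreal (normal_density 0 (sqrt (1 - a\<^sup>2)) (x - a * z)) \<partial>lborel)" for x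
    proof -
      have eq: "exp (- well k z) / Z * normal_density 0 (sqrt v) (x - a * z)
          = C * exp (- x\<^sup>2 / (2 * v)) * (W z * exp ((b * x) * z))" for z
      proof -
        have "- (x - a * z)\<^sup>2 / (2 * v) = - x\<^sup>2 / (2 * v) + (- l * z\<^sup>2 / 2 + (b * x) * z)"
          using v by (simp add: b_def l_def field_simps power2_eq_square)
        then have "exp (- (x - a * z)\<^sup>2 / (2 * v))
            = exp (- x\<^sup>2 / (2 * v)) * (exp (- l * z\<^sup>2 / 2) * exp ((b * x) * z))"
          by (simp only: exp_add)
        moreover have "W z = exp (- well k z) * exp (- l * z\<^sup>2 / 2)"
          unfolding W_def by (simp flip: exp_add)
        ultimately show ?thesis
          using v by (simp add: normal_density_def C_def)
      qed
      have "(\<integral>\<^sup>+z. ennreal (exp (- well k z) / Z) * ennreal (normal_density 0 (sqrt v) (x - a * z)) \<partial>lborel)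
          = (\<integral>\<^sup>+z. ennreal (C * exp (- x\<^sup>2 / (2 * v)) * (W z * exp ((b * x) * z))) \<partial>lborel)"
        unfolding eq[symmetric] using \<open>Z > 0\<close> by (intro nn_integral_cong ennreal_mult[symmetric]) auto
      also have "\<dots> = ennreal (\<integral>z. C * exp (- x\<^sup>2 / (2 * v)) * (W z * exp ((b * x) * z)) \<partial>lborel)"
        using C IW[of "b * x"] by (intro nn_integral_eq_integral) (auto simp: W_def)
      also have "\<dots> = ennreal (q x)" by (simp add: q_def F0_def)
      finally show ?thesis by (simp add: v_def Z_def)
    qed
    show "\<bar>u'' 0\<bar> \<ge> a\<^sup>2 * k / 2 - 1"
    \<comment> \<open>If \<open>a\<^sup>2 * k / 2 < 1\<close>, the claimed bound is negative.
      Otherwise \<open>a\<^sup>2 * k / 2 - 1\<close> is nonnegative, and dividing by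
      \<open>v \<le> 1\<close> only enlarges it.\<close>
    proof (cases "a\<^sup>2 * k / 2 \<ge> 1")
      case True
      have "W (- z) = W z" for z by (simp add: W_def well_def)
      then have "F1 0 = 0" unfolding F1_def by (intro integral_odd_eq_0) simp
      have "k / 2 * F0 0 \<le> (1 - l) * k * F0 0"
        using l assms F0[of 0] by (intro mult_right_mono) auto
      also have "\<dots> \<le> F2 0"
        using well_second_moment[of k l] assms l by (simp add: F0_def F2_def W_def)
      finally have "k / 2 \<le> F2 0 / F0 0" using F0[of 0] by (simp add: field_simps)
      then have "b\<^sup>2 * (k / 2) \<le> b\<^sup>2 * (F2 0 / F0 0)" by (intro mult_left_mono) auto
      then have "b\<^sup>2 * (k / 2) - 1 / v \<le> u'' 0"
        using F0[of 0] \<open>F1 0 = 0\<close> by (simp add: u''_def power2_eq_square)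
      moreover have "a\<^sup>2 * k / 2 - 1 \<le> 1 / v * (a\<^sup>2 * k / 2 - 1)"
        using v True mult_right_mono[of 1 "1 / v" "a\<^sup>2 * k / 2 - 1"] by simp
      moreover have "1 / v * (a\<^sup>2 * k / 2 - 1) \<le> b\<^sup>2 * (k / 2) - 1 / v"
      proof -
        have "1 / v \<le> 1 / v\<^sup>2" using v by (simp add: divide_simps power2_eq_square)
        then have "1 / v * (a\<^sup>2 * k / 2) \<le> 1 / v\<^sup>2 * (a\<^sup>2 * k / 2)"
          using assms by (intro mult_right_mono) auto
        then show ?thesis by (simp add: b_def power_divide right_diff_distrib)
      qed
      ultimately show ?thesis by (meson abs_ge_self order_trans)
    qed auto
  qed
qed

subsection \<open>The Ornstein--Uhlenbeck noise\<close>

text \<open>Left-endpoint sums for the stochastic integral \<open>sqrt 2 \<integral> e\<^sup>u\<^sup>-\<^sup>t dB\<^sub>u\<close> over \<open>[0, t]\<close>.\<close>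

definition ou_sum :: "real \<Rightarrow> (real \<Rightarrow> real) \<Rightarrow> nat \<Rightarrow> real" where
  "ou_sum t b n = (\<Sum>k<n. (sqrt 2 * exp (real k * (t / n) - t)) *
     (b (real (Suc k) * (t / n)) - b (real k * (t / n))))"

text \<open>Summation by parts: the sum differs from \<open>X t - e\<^sup>-\<^sup>t X 0\<close> by integrals of
  \<open>e\<^sup>\<tau>\<^sup>-\<^sup>t X u - e\<^sup>u\<^sup>-\<^sup>t X \<tau>'\<close> over the grid cells \<open>[\<tau>, \<tau>']\<close>.\<close>

lemma ou_sum_tendsto:
  assumes "t > 0" and cont: "continuous_on {0..} X"
    and eq: "\<And>t. t \<ge> 0 \<Longrightarrow> X t = X 0 - integral {0..t} X + sqrt 2 * b t"
  shows "ou_sum t b \<longlonglongrightarrow> X t - exp (- t) * X 0"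
proof (rule LIMSEQ_I)
  fix r :: real assume "r > 0"
  have cont_t: "continuous_on {0..t} X" using cont by (rule continuous_on_subset) auto
  from compact_continuous_image[OF cont_t] have "bounded (X ` {0..t})"
    by (simp add: compact_imp_bounded)
  then obtain m where m: "m > 0" "\<And>u. u \<in> {0..t} \<Longrightarrow> \<bar>X u\<bar> \<le> m"
    by (auto simp: bounded_pos)
  \<comment> \<open>Each grid cell will contribute an error of at most \<open>e * (1 + m)\<close>
    times its length, so the total is \<open>r / 2\<close>.\<close>
  define e where "e = r / (2 * ((1 + m) * t))"
  have e: "e > 0" using \<open>r > 0\<close> \<open>t > 0\<close> m by (simp add: e_def)
  have "uniformly_continuous_on {0..t} X"
    by (intro compact_uniformly_continuous cont_t) simp
  then obtain d1 where d1: "d1 > 0"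
    "\<And>u w. u \<in> {0..t} \<Longrightarrow> w \<in> {0..t} \<Longrightarrow> \<bar>w - u\<bar> < d1 \<Longrightarrow> \<bar>X w - X u\<bar> < e"
    unfolding uniformly_continuous_on_def dist_real_def using e by metis
  have "uniformly_continuous_on {0..t} (\<lambda>u. exp (u - t))"
    by (intro compact_uniformly_continuous continuous_intros) simp
  then obtain d2 where d2: "d2 > 0"
    "\<And>u w. u \<in> {0..t} \<Longrightarrow> w \<in> {0..t} \<Longrightarrow> \<bar>w - u\<bar> < d2 \<Longrightarrow> \<bar>exp (w - t) - exp (u - t)\<bar> < e"
    unfolding uniformly_continuous_on_def dist_real_def using e by metis
  obtain N :: nat where N: "real N > t / min d1 d2" using reals_Archimedean2 by blast
  have "norm (ou_sum t b n - (X t - exp (- t) * X 0)) < r" if n: "n \<ge> N + 1" for n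
  proof -
    define g where "g k = real k * (t / n)" for k
    have n0: "n > 0" using n by simp
    have g_step: "g (Suc k) - g k = t / n" for k by (simp only: g_def of_nat_Suc distrib_right mult_1 add_diff_cancel_right')
    have "t / n \<ge> 0" using \<open>t > 0\<close> by simp
    then have g_le: "0 \<le> g k" "g k \<le> g (Suc k)" for k
      using g_step[of k] \<open>t > 0\<close> by (simp add: g_def, linarith)
    have g_t: "g k \<le> t" if "k \<le> n" for k
      using that n0 \<open>t > 0\<close> by (simp add: g_def field_simps)
    have "t / min d1 d2 < real n" using N n by linarith
    moreover have "min d1 d2 > 0" using d1(1) d2(1) by simp
    ultimately have "t / n < min d1 d2"
      using n0 by (simp only: divide_less_eq of_nat_0_less_iff mult.commute if_True)
    then have step: "t / n < d1" "t / n < d2" by simp_all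
    define D where "D k = sqrt 2 * exp (g k - t) * (b (g (Suc k)) - b (g k))
       - (exp (g (Suc k) - t) * X (g (Suc k)) - exp (g k - t) * X (g k))" for k
    have D: "\<bar>D k\<bar> \<le> e * (1 + m) * (t / n)" if k: "k < n" for k
    proof -
      let ?I = "{g k..g (Suc k)}"
      have sub: "?I \<subseteq> {0..t}" using g_le[of k] g_t[of "Suc k"] k by auto
      have X_int: "X integrable_on {0..g (Suc k)}" "X integrable_on ?I"
        using continuous_on_subset[OF cont] continuous_on_subset[OF cont_t sub]
        by (auto intro!: integrable_continuous_real)
      have "integral {0..g k} X + integral ?I X = integral {0..g (Suc k)} X"
        by (intro Henstock_Kurzweil_Integration.integral_combine X_int g_le)
      moreover have "g (Suc k) \<ge> 0" "g k \<ge> 0" using g_le by blast+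
      ultimately have bX: "sqrt 2 * (b (g (Suc k)) - b (g k)) = X (g (Suc k)) - X (g k) + integral ?I X"
        using eq[of "g (Suc k)"] eq[of "g k"] by (simp add: algebra_simps)
      \<comment> \<open>The increment of the weight over the cell is the integral of the weight
        itself. This turns the whole cell error \<open>D k\<close> into one integral with a
        pointwise small integrand.\<close>
      have "((\<lambda>u. exp (u - t)) has_integral exp (g (Suc k) - t) - exp (g k - t)) ?I"
        by (intro fundamental_theorem_of_calculus g_le)
           (auto intro!: derivative_eq_intros simp flip: has_real_derivative_iff_has_vector_derivative)
      then have "((\<lambda>u. exp (g k - t) * X u - exp (u - t) * X (g (Suc k))) has_integral
          exp (g k - t) * integral ?I X - (exp (g (Suc k) - t) - exp (g k - t)) * X (g (Suc k))) ?I"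
        by (intro has_integral_diff has_integral_mult_right has_integral_mult_left
              integrable_integral X_int)
      moreover have "exp (g k - t) * integral ?I X - (exp (g (Suc k) - t) - exp (g k - t)) * X (g (Suc k)) = D k"
      proof -
        have "D k = exp (g k - t) * (sqrt 2 * (b (g (Suc k)) - b (g k)))
          - (exp (g (Suc k) - t) * X (g (Suc k)) - exp (g k - t) * X (g k))"
          by (simp add: D_def)
        then show ?thesis unfolding bX by (simp add: algebra_simps)
      qed
      ultimately have "((\<lambda>u. exp (g k - t) * X u - exp (u - t) * X (g (Suc k))) has_integral D k) ?I"
        by simp
      then have "norm (D k) \<le> e * (1 + m) * Henstock_Kurzweil_Integration.content ?I"
      proof (rule has_integral_bound_real[rotated 2, where S = "{}"])
        show "0 \<le> e * (1 + m)" using e m by simp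
        show "finite {}" by simp
        fix u assume u: "u \<in> ?I - {}"
        then have u': "u \<in> {0..t}" "g (Suc k) \<in> {0..t}" "g k \<in> {0..t}"
          using sub g_le[of k] by auto
        have "\<bar>u - g (Suc k)\<bar> \<le> t / n" "\<bar>g k - u\<bar> \<le> t / n" using u g_step[of k] by auto
        then have 1: "\<bar>X u - X (g (Suc k))\<bar> \<le> e" "\<bar>exp (g k - t) - exp (u - t)\<bar> \<le> e"
          using d1(2)[of "g (Suc k)" u] d2(2)[of u "g k"] u' step by (simp_all add: less_imp_le)
        \<comment> \<open>Adding and subtracting a mixed term separates the oscillation of
          \<open>X\<close> from that of the weight; the weight is at most 1 and \<open>X\<close> at
          most \<open>m\<close>.\<close>
        have "exp (g k - t) * X u - exp (u - t) * X (g (Suc k)) =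
          exp (g k - t) * (X u - X (g (Suc k))) + (exp (g k - t) - exp (u - t)) * X (g (Suc k))"
          by (simp add: algebra_simps)
        also have "\<bar>\<dots>\<bar> \<le> exp (g k - t) * \<bar>X u - X (g (Suc k))\<bar>
            + \<bar>exp (g k - t) - exp (u - t)\<bar> * \<bar>X (g (Suc k))\<bar>"
          by (rule order_trans[OF abs_triangle_ineq]) (simp add: abs_mult)
        also have "\<dots> \<le> 1 * e + e * m"
          using 1 m u' e by (intro add_mono mult_mono) auto
        finally show "norm (exp (g k - t) * X u - exp (u - t) * X (g (Suc k))) \<le> e * (1 + m)"
          by (simp add: algebra_simps)
      qed
      then show ?thesis using g_step[of k] g_le[of k] by simp
    qed
    have "(\<Sum>k<n. exp (g (Suc k) - t) * X (g (Suc k)) - exp (g k - t) * X (g k)) = X t - exp (- t) * X 0"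
      using n0 by (subst sum_lessThan_telescope) (simp add: g_def)
    then have "ou_sum t b n - (X t - exp (- t) * X 0) = (\<Sum>k<n. D k)"
      by (simp add: ou_sum_def D_def sum_subtractf g_def)
    also have "norm \<dots> \<le> (\<Sum>k<n. e * (1 + m) * (t / n))"
      unfolding real_norm_def by (rule order_trans[OF sum_abs]) (intro sum_mono D, simp)
    also have "\<dots> = e * ((1 + m) * t)" using n0 by simp
    also have "\<dots> = r / 2" using m(1) \<open>t > 0\<close> unfolding e_def by (simp del: distrib_right_numeral)
    also have "\<dots> < r" using \<open>r > 0\<close> by simp
    finally show ?thesis .
  qed
  then show "\<exists>no. \<forall>n\<ge>no. norm (ou_sum t b n - (X t - exp (- t) * X 0)) < r" by blast
qed

section \<open>Gaussian law of the noise via characteristic functions\<close>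

lemma char_normal_distributed:
  assumes "prob_space M" "distributed M lborel X (\<lambda>x. ennreal (normal_density 0 \<sigma> x))" "\<sigma> > 0"
  shows "char (distr M borel (\<lambda>\<omega>. c * X \<omega>)) \<xi> = exp (- (c\<^sup>2 * \<sigma>\<^sup>2) * \<xi>\<^sup>2 / 2)"
proof -
  interpret prob_space M by fact
  have X: "X \<in> measurable M borel" using assms(2) by (simp add: distributed_def)
  have [measurable]: "(\<lambda>\<omega>. X \<omega> / \<sigma>) \<in> borel_measurable M" using X by measurable
  have "distributed M lborel (\<lambda>\<omega>. X \<omega> / \<sigma>) (\<lambda>x. ennreal (std_normal_density x))"
    using normal_standard_normal_convert[of \<sigma> X 0] assms by simp
  then have std: "distr M borel (\<lambda>\<omega>. X \<omega> / \<sigma>) = std_normal_distribution"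
    by (simp add: distributed_def cong: distr_cong)
  have "char (distr M borel (\<lambda>\<omega>. c * X \<omega>)) \<xi> = (\<integral>\<omega>. iexp (\<xi> * (c * X \<omega>)) \<partial>M)"
    using X by (simp add: char_def integral_distr)
  also have "\<dots> = (\<integral>\<omega>. iexp ((\<xi> * c * \<sigma>) * (X \<omega> / \<sigma>)) \<partial>M)"
    using assms by (simp add: mult.assoc)
  also have "\<dots> = char (distr M borel (\<lambda>\<omega>. X \<omega> / \<sigma>)) (\<xi> * c * \<sigma>)"
    unfolding char_def by (subst integral_distr) auto
  also have "\<dots> = exp (- (c\<^sup>2 * \<sigma>\<^sup>2) * \<xi>\<^sup>2 / 2)"
    by (simp add: std char_std_normal_distribution power_mult_distrib mult.commute mult.left_commute)
  finally show ?thesis .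
qed

text \<open>The sum consists of independent centred Gaussians, so characteristic functions multiply
  and variances add. The total variance is a left Riemann sum of
  \<open>2 * exp (2 * (u - t))\<close> over \<open>[0, t]\<close>.\<close>

lemma char_ou_sum:
  assumes B: "brownian_motion_1d M B" and "t > 0" "n > 0"
  shows "char (distr M borel (\<lambda>\<omega>. ou_sum t (\<lambda>s. B s \<omega>) n)) \<xi>
    = exp (- (\<Sum>k<n. 2 * exp (2 * (real k * (t / n) - t)) * (t / n)) * \<xi>\<^sup>2 / 2)"
proof -
  interpret prob_space M using B by (simp add: brownian_motion_1d_def)
  let ?\<tau> = "\<lambda>k. real k * (t / n)"
  let ?c = "\<lambda>k. sqrt 2 * exp (?\<tau> k - t)"
  have "t / n > 0" using assms by simp
  \<comment> \<open>Independence of increments is stated for infinite strictly increasing sequences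
    of times, so the grid is continued beyond \<open>t\<close>.\<close>
  then have mono: "strict_mono ?\<tau>"
    by (intro strict_monoI mult_strict_right_mono) auto
  have "\<forall>\<tau> n. 0 \<le> \<tau> 0 \<and> strict_mono \<tau> \<longrightarrow>
      indep_vars (\<lambda>_. borel) (\<lambda>k \<omega>. B (\<tau> (Suc k)) \<omega> - B (\<tau> k) \<omega>) {..<n :: nat}"
    using B unfolding brownian_motion_1d_def by blast
  from this[rule_format, of ?\<tau> n] mono
  have "indep_vars (\<lambda>_. borel) (\<lambda>k \<omega>. B (?\<tau> (Suc k)) \<omega> - B (?\<tau> k) \<omega>) {..<n}"
    by simp
  then have "indep_vars (\<lambda>_. borel) (\<lambda>k \<omega>. ?c k * (B (?\<tau> (Suc k)) \<omega> - B (?\<tau> k) \<omega>)) {..<n}"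
    by (rule indep_vars_compose2) simp
  from char_distr_sum[OF this]
  have "char (distr M borel (\<lambda>\<omega>. ou_sum t (\<lambda>s. B s \<omega>) n)) \<xi>
    = (\<Prod>k<n. char (distr M borel (\<lambda>\<omega>. ?c k * (B (?\<tau> (Suc k)) \<omega> - B (?\<tau> k) \<omega>))) \<xi>)"
    by (simp add: ou_sum_def)
  also have "\<dots> = (\<Prod>k<n. complex_of_real (exp (- (2 * exp (2 * (?\<tau> k - t)) * (t / n)) * \<xi>\<^sup>2 / 2)))"
  proof (rule prod.cong)
    fix k assume "k \<in> {..<n}"
    have "?\<tau> k \<ge> 0" using assms by simp
    moreover have "?\<tau> k < ?\<tau> (Suc k)" by (rule strict_monoD[OF mono]) simp
    ultimately have "distributed M lborel (\<lambda>\<omega>. B (?\<tau> (Suc k)) \<omega> - B (?\<tau> k) \<omega>)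
        (\<lambda>x. ennreal (normal_density 0 (sqrt (?\<tau> (Suc k) - ?\<tau> k)) x))"
      using B unfolding brownian_motion_1d_def by blast
    moreover have "?\<tau> (Suc k) - ?\<tau> k = t / n"
      by (simp only: of_nat_Suc distrib_right mult_1 add_diff_cancel_right')
    ultimately have "distributed M lborel (\<lambda>\<omega>. B (?\<tau> (Suc k)) \<omega> - B (?\<tau> k) \<omega>)
        (\<lambda>x. ennreal (normal_density 0 (sqrt (t / n)) x))"
      by simp
    note char = char_normal_distributed[OF prob_space_axioms this, of "?c k" \<xi>]
    have "(?c k)\<^sup>2 = 2 * exp (2 * (?\<tau> k - t))" "(sqrt (t / n))\<^sup>2 = t / n"
      using assms unfolding power_mult_distrib exp_double by simp_all
    then show "char (distr M borel (\<lambda>\<omega>. ?c k * (B (?\<tau> (Suc k)) \<omega> - B (?\<tau> k) \<omega>))) \<xi>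
        = complex_of_real (exp (- (2 * exp (2 * (?\<tau> k - t)) * (t / n)) * \<xi>\<^sup>2 / 2))"
      using char \<open>t / n > 0\<close> by (simp only: real_sqrt_gt_0_iff simp_thms)
  qed simp
  also have "\<dots> = complex_of_real (exp (\<Sum>k<n. - (2 * exp (2 * (?\<tau> k - t)) * (t / n)) * \<xi>\<^sup>2 / 2))"
    by (simp add: exp_sum)
  also have "(\<Sum>k<n. - (2 * exp (2 * (?\<tau> k - t)) * (t / n)) * \<xi>\<^sup>2 / 2)
      = - (\<Sum>k<n. 2 * exp (2 * (?\<tau> k - t)) * (t / n)) * \<xi>\<^sup>2 / 2"
    by (simp add: sum_distrib_right sum_divide_distrib sum_negf)
  finally show ?thesis .
qed

text \<open>The Riemann sum is geometric and has a closed form, so its limit is an explicit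
  asymptotic computation.\<close>

lemma ou_variance_tendsto:
  assumes "t > 0"
  shows "(\<lambda>n. \<Sum>k<n. 2 * exp (2 * (real k * (t / n) - t)) * (t / n)) \<longlonglongrightarrow> 1 - exp (- 2 * t)"
proof -
  have eq: "(\<Sum>k<n. 2 * exp (2 * (real k * (t / n) - t)) * (t / n))
      = 2 * (t / n) * exp (- 2 * t) * (exp (2 * t) - 1) / (exp (2 * (t / n)) - 1)" if "n > 0" for n :: nat
  proof -
    have "(\<Sum>k<n. 2 * exp (2 * (real k * (t / n) - t)) * (t / n))
        = 2 * (t / n) * exp (- 2 * t) * (\<Sum>k<n. exp (2 * (t / n)) ^ k)"
      unfolding sum_distrib_left
    proof (rule sum.cong)
      fix k
      have *: "exp (2 * (real k * c - t)) = exp (- 2 * t) * exp (2 * c) ^ k" for c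
        unfolding exp_of_nat_mult[symmetric] exp_add[symmetric]
        by (rule arg_cong[of _ _ exp]) (simp add: algebra_simps)
      then show "2 * exp (2 * (real k * (t / n) - t)) * (t / n) = 2 * (t / n) * exp (- 2 * t) * exp (2 * (t / n)) ^ k"
        by (subst *) simp
    qed simp
    also have "(\<Sum>k<n. exp (2 * (t / n)) ^ k) = (exp (2 * (t / n)) ^ n - 1) / (exp (2 * (t / n)) - 1)"
      using assms that by (intro geometric_sum) simp
    also have "exp (2 * (t / n)) ^ n = exp (2 * t)"
      using that by (simp flip: exp_of_nat_mult)
    finally show ?thesis by simp
  qed
  have "(\<lambda>n::nat. 2 * (t / n) * exp (- 2 * t) * (exp (2 * t) - 1) / (exp (2 * (t / n)) - 1))
      \<longlonglongrightarrow> exp (- 2 * t) * (exp (2 * t) - 1)"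
    using assms by real_asymp
  also have "exp (- 2 * t) * (exp (2 * t) - 1) = 1 - exp (- 2 * t)"
    by (simp add: right_diff_distrib flip: exp_add)
  finally show ?thesis
    by (rule Lim_transform_eventually) (use eq in \<open>auto intro!: eventually_mono[OF eventually_gt_at_top[of 0]]\<close>)
qed

text \<open>Almost sure convergence of the sums carries over to characteristic functions by
  dominated convergence with bound 1. The limit is that of a Gaussian, and Levy's uniqueness theorem
  identifies the law.\<close>

lemma distr_ou_noise:
  assumes B: "brownian_motion_1d M B" and "t > 0"
    and [measurable]: "N \<in> borel_measurable M"
    and lim: "AE \<omega> in M. ou_sum t (\<lambda>s. B s \<omega>) \<longlonglongrightarrow> N \<omega>"
  shows "distr M borel N = density lborel (\<lambda>x. ennreal (normal_density 0 (sqrt (1 - exp (- 2 * t))) x))"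
proof -
  interpret prob_space M using B by (simp add: brownian_motion_1d_def)
  let ?\<sigma> = "sqrt (1 - exp (- 2 * t))"
  let ?n = "density lborel (\<lambda>x. ennreal (normal_density 0 ?\<sigma> x))"
  have \<sigma>: "?\<sigma> > 0" using \<open>t > 0\<close> by simp
  interpret n: prob_space ?n using \<sigma> by (rule prob_space_normal_density)
  have [measurable]: "(\<lambda>\<omega>. ou_sum t (\<lambda>s. B s \<omega>) n) \<in> borel_measurable M" for n
  proof -
    have "B s \<in> borel_measurable M" if "s \<ge> 0" for s
      using B that by (simp add: brownian_motion_1d_def)
    then show ?thesis unfolding ou_sum_def using \<open>t > 0\<close>
      by (intro borel_measurable_sum borel_measurable_times borel_measurable_diff) auto
  qed
  have "char (distr M borel N) \<xi> = char ?n \<xi>" for \<xi>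
  proof (rule LIMSEQ_unique)
    have "(\<lambda>n. \<integral>\<omega>. iexp (\<xi> * ou_sum t (\<lambda>s. B s \<omega>) n) \<partial>M) \<longlonglongrightarrow> (\<integral>\<omega>. iexp (\<xi> * N \<omega>) \<partial>M)"
    proof (rule integral_dominated_convergence[where w = "\<lambda>_. 1"])
      show "AE \<omega> in M. (\<lambda>n. iexp (\<xi> * ou_sum t (\<lambda>s. B s \<omega>) n)) \<longlonglongrightarrow> iexp (\<xi> * N \<omega>)"
        using lim by eventually_elim (intro tendsto_intros)
    qed auto
    then show "(\<lambda>n. char (distr M borel (\<lambda>\<omega>. ou_sum t (\<lambda>s. B s \<omega>) n)) \<xi>) \<longlonglongrightarrow> char (distr M borel N) \<xi>"
      by (simp add: char_def integral_distr)
    have "(\<lambda>n. complex_of_real (exp (- (\<Sum>k<n. 2 * exp (2 * (real k * (t / n) - t)) * (t / n)) * \<xi>\<^sup>2 / 2)))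
        \<longlonglongrightarrow> complex_of_real (exp (- (1 - exp (- 2 * t)) * \<xi>\<^sup>2 / 2))"
      by (intro tendsto_intros ou_variance_tendsto \<open>t > 0\<close>) simp
    moreover have "char ?n \<xi> = complex_of_real (exp (- (1 - exp (- 2 * t)) * \<xi>\<^sup>2 / 2))"
    proof -
      have "distributed ?n lborel (\<lambda>x. x) (\<lambda>x. ennreal (normal_density 0 ?\<sigma> x))"
        by (simp add: distributed_def distr_id2)
      from char_normal_distributed[OF n.prob_space_axioms this \<sigma>, of 1 \<xi>] show ?thesis
        using \<open>t > 0\<close> by (simp add: distr_id2)
    qed
    ultimately have "(\<lambda>n. complex_of_real (exp (- (\<Sum>k<n. 2 * exp (2 * (real k * (t / n) - t)) * (t / n)) * \<xi>\<^sup>2 / 2)))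
        \<longlonglongrightarrow> char ?n \<xi>" by simp
    then show "(\<lambda>n. char (distr M borel (\<lambda>\<omega>. ou_sum t (\<lambda>s. B s \<omega>) n)) \<xi>) \<longlonglongrightarrow> char ?n \<xi>"
      by (rule Lim_transform_eventually)
         (auto intro!: eventually_mono[OF eventually_gt_at_top[of 0]] simp: char_ou_sum[OF B \<open>t > 0\<close>])
  qed
  moreover have "real_distribution ?n"
    by (intro real_distribution.intro real_distribution_axioms.intro n.prob_space_axioms) simp_all
  moreover have "real_distribution (distr M borel N)"
    by (rule real_distribution_distr) simp
  ultimately show ?thesis by (intro Levy_uniqueness ext)
qed

subsection \<open>The law of the process at a fixed time\<close>

text \<open>The gradient of a separable potential acts coordinatewise, so the Lipschitz constant 3
  of one coordinate passes unchanged to the Euclidean norm in every dimension.\<close>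

lemma log_smooth_well:
  assumes "k > 0"
  defines "Z \<equiv> \<integral>w. exp (- well k w) \<partial>lborel"
  defines "m \<equiv> \<lambda>z. exp (- well k z) / Z"
  shows "prob_space (density lborel (\<lambda>x. ennreal (m x)))"
    and "log_smooth d 3 (Pi\<^sub>M {..<d} (\<lambda>_. density lborel (\<lambda>x. ennreal (m x))))"
proof -
  have "exp_integrable (\<lambda>z. exp (- well k z - 0 * z\<^sup>2 / 2))"
    using assms by (intro well_exp_integrable) auto
  from exp_integrable_integrable[OF this, of 0]
  have I: "integrable lborel (\<lambda>z. exp (- well k z))" by simp
  then have "Z > 0" unfolding Z_def by (rule integral_pos_real) simp
  have [measurable]: "m \<in> borel_measurable borel" unfolding m_def well_def by measurable
  have "(\<integral>\<^sup>+z. ennreal (m z) \<partial>lborel) = ennreal (\<integral>z. m z \<partial>lborel)"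
    using I \<open>Z > 0\<close> unfolding m_def by (intro nn_integral_eq_integral) auto
  also have "(\<integral>z. m z \<partial>lborel) = 1"
    using \<open>Z > 0\<close> by (simp add: m_def flip: Z_def)
  finally show m: "prob_space (density lborel (\<lambda>x. ennreal (m x)))"
    by (intro prob_spaceI) (simp add: emeasure_density)
  then interpret P: product_prob_space "\<lambda>_. density lborel (\<lambda>x. ennreal (m x))" "{..<d}"
    by (simp add: product_prob_space_def product_prob_space_axioms_def product_sigma_finite_def
        prob_space_imp_sigma_finite)
  define G :: "(nat \<Rightarrow> real) \<Rightarrow> nat \<Rightarrow> real"
    where "G x i = x i - 2 * sqrt k * sin (x i / sqrt k)" for x i
  show "log_smooth d 3 (Pi\<^sub>M {..<d} (\<lambda>_. density lborel (\<lambda>x. ennreal (m x))))"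
    unfolding log_smooth_def
  proof (intro conjI exI[of _ "\<lambda>x. \<Sum>i<d. well k (x i)"] exI[of _ G] exI[of _ "Z ^ d"] ballI)
    show "prob_space (Pi\<^sub>M {..<d} (\<lambda>_. density lborel (\<lambda>x. ennreal (m x))))"
      by (rule P.prob_space_axioms)
    show "Z ^ d > 0" using \<open>Z > 0\<close> by simp
    have "(\<Prod>i<d. ennreal (m (x i))) = ennreal (exp (- (\<Sum>i<d. well k (x i))) / Z ^ d)" for x
      using \<open>Z > 0\<close>
      by (subst prod_ennreal) (auto simp: m_def prod_dividef exp_sum simp flip: sum_negf)
    then show "Pi\<^sub>M {..<d} (\<lambda>_. density lborel (\<lambda>x. ennreal (m x)))
        = density (leb d) (\<lambda>x. ennreal (exp (- (\<Sum>i<d. well k (x i))) / Z ^ d))"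
      using PiM_density_lborel[OF _ _ m, of "{..<d}"] by simp
    fix x y :: "nat \<Rightarrow> real"
    show "has_gradient d (\<lambda>x. \<Sum>i<d. well k (x i)) (G x) x"
      unfolding G_def using \<open>k > 0\<close> by (intro has_gradient_separable well_has_derivative)
    have "enorm d (\<lambda>i. G x i - G y i) = enorm d (\<lambda>i. \<bar>G x i - G y i\<bar>)" by (simp add: L2_set_def)
    also have "\<dots> \<le> enorm d (\<lambda>i. 3 * \<bar>x i - y i\<bar>)"
      unfolding G_def using \<open>k > 0\<close> by (intro L2_set_mono well_deriv_lipschitz) auto
    also have "\<dots> = 3 * enorm d (\<lambda>i. x i - y i)"
      by (subst L2_set_right_distrib[symmetric]) (simp_all add: L2_set_def)
    finally show "enorm d (\<lambda>i. G x i - G y i) \<le> 3 * enorm d (\<lambda>i. x i - y i)" .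
  qed
qed

text \<open>This is variation of constants, with the stochastic integral replaced by a functional of
  the Brownian path. Such a form is essential: \<open>X t - exp (- t) * X 0\<close> mentions
  \<open>X 0\<close>, so its independence of \<open>X 0\<close> becomes visible only once it is
  expressed through \<open>B\<close> alone.\<close>

lemma ou_decomposition:
  assumes OU: "ornstein_uhlenbeck d M B X" and "t > 0" and "d \<ge> 1"
  obtains N where
    "prob_space.indep_var M (leb d) (X 0) (leb d) N"
    "distr M (leb d) N = Pi\<^sub>M {..<d} (\<lambda>_. density lborel (\<lambda>x. ennreal (normal_density 0 (sqrt (1 - exp (- 2 * t))) x)))"
    "AE \<omega> in M. X t \<omega> = (\<lambda>i\<in>{..<d}. exp (- t) * X 0 \<omega> i + N \<omega> i)"
proof -
  have BM: "brownian_motion d M B" using OU by (simp add: ornstein_uhlenbeck_def)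
  then interpret prob_space M by (simp add: brownian_motion_def)
  let ?P = "Pi\<^sub>M {0..} (\<lambda>_. borel) :: (real \<Rightarrow> real) measure"
  let ?path = "\<lambda>i \<omega>. \<lambda>t\<in>{0..}. B t \<omega> i"
  have B1: "brownian_motion_1d M (\<lambda>t \<omega>. B t \<omega> i)" if "i < d" for i
    using BM that by (simp add: brownian_motion_def)
  have B_meas [measurable]: "(\<lambda>\<omega>. B s \<omega> i) \<in> borel_measurable M" if "i < d" "s \<ge> 0" for i s
    using B1[OF that(1)] that(2) by (simp add: brownian_motion_1d_def)
  have X_meas [measurable]: "X s \<in> measurable M (leb d)" if "s \<ge> 0" for s
    using OU that by (simp add: ornstein_uhlenbeck_def)
  \<comment> \<open>\<open>lim\<close> gives a measurable functional on all of path space. Where the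
    sums diverge its value is irrelevant, since almost every path has convergent sums.\<close>
  define G where "G b = lim (ou_sum t b)" for b
  have [measurable]: "(\<lambda>b. ou_sum t b n) \<in> borel_measurable ?P" for n
    unfolding ou_sum_def using \<open>t > 0\<close>
    by (intro borel_measurable_sum borel_measurable_times borel_measurable_diff measurable_component_singleton
          borel_measurable_const) auto
  have G [measurable]: "G \<in> borel_measurable ?P"
    unfolding G_def by measurable
  define N where "N \<omega> = (\<lambda>i\<in>{..<d}. G (?path i \<omega>))" for \<omega>
  have path_meas: "?path i \<in> measurable M ?P" if "i < d" for i
    using that by (intro measurable_restrict B_meas) auto
  \<comment> \<open>All grid times are nonnegative, so restricting the path to \<open>{0..}\<close>
    does not change the sums.\<close>
  have ou_path: "ou_sum t (?path i \<omega>) = ou_sum t (\<lambda>s. B s \<omega> i)" for i \<omega>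
    using \<open>t > 0\<close> unfolding ou_sum_def by (intro ext sum.cong) auto
  have lim: "AE \<omega> in M. \<forall>i<d. ou_sum t (\<lambda>s. B s \<omega> i) \<longlonglongrightarrow> X t \<omega> i - exp (- t) * X 0 \<omega> i"
  proof -
    have "AE \<omega> in M. \<forall>i<d. continuous_on {0..} (\<lambda>t. X t \<omega> i) \<and>
        (\<forall>t\<ge>0. X t \<omega> i = X 0 \<omega> i - integral {0..t} (\<lambda>u. X u \<omega> i) + sqrt 2 * B t \<omega> i)"
      using OU unfolding ornstein_uhlenbeck_def by blast
    then show ?thesis
    proof eventually_elim
      case (elim \<omega>)
      show ?case
      proof (intro allI impI)
        fix i assume "i < d"
        show "ou_sum t (\<lambda>s. B s \<omega> i) \<longlonglongrightarrow> X t \<omega> i - exp (- t) * X 0 \<omega> i"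
          by (rule ou_sum_tendsto[where X = "\<lambda>t. X t \<omega> i", OF \<open>t > 0\<close>])
            (use elim \<open>i < d\<close> in blast)+
      qed
    qed
  qed
  have N_eq: "AE \<omega> in M. \<forall>i<d. G (?path i \<omega>) = X t \<omega> i - exp (- t) * X 0 \<omega> i"
    using lim by eventually_elim (simp add: G_def ou_path limI)
  show ?thesis
  proof (rule that[of N])
    let ?BP = "Pi\<^sub>M {..<d} (\<lambda>_. ?P)"
    let ?V = "vimage_algebra (space M) (\<lambda>\<omega>. \<lambda>i\<in>{..<d}. ?path i \<omega>) ?BP"
    have path: "(\<lambda>\<omega>. \<lambda>i\<in>{..<d}. ?path i \<omega>) \<in> measurable M ?BP"
      by (intro measurable_restrict path_meas) auto
    have Gd: "(\<lambda>p. \<lambda>i\<in>{..<d}. G (p i)) \<in> measurable ?BP (leb d)"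
      by (intro measurable_restrict measurable_compose[OF _ G, simplified]) auto
    have N_path: "N = (\<lambda>\<omega>. (\<lambda>p. \<lambda>i\<in>{..<d}. G (p i)) (\<lambda>i\<in>{..<d}. ?path i \<omega>))"
      by (auto simp: N_def fun_eq_iff)
    have "N \<in> measurable ?V (leb d)"
      unfolding N_path
      by (intro measurable_compose[OF measurable_vimage_algebra1 Gd] funcsetI measurable_space[OF path])
    \<comment> \<open>\<open>N\<close> generates a smaller sigma-algebra than the whole path, so it
      inherits the independence of \<open>X 0\<close>.\<close>
    then have "sets (vimage_algebra (space M) N (leb d)) \<subseteq> sets ?V"
      by (intro sets_image_in_sets) auto
    moreover have "indep_set (sets (vimage_algebra (space M) (X 0) (leb d))) (sets ?V)"
      using OU unfolding ornstein_uhlenbeck_def by blast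
    ultimately have "indep_set (sets (vimage_algebra (space M) (X 0) (leb d)))
        (sets (vimage_algebra (space M) N (leb d)))"
      unfolding indep_set_def by (elim indep_sets_mono_sets) (auto split: bool.split)
    moreover have "N \<in> measurable M (leb d)"
      unfolding N_path by (rule measurable_compose[OF path Gd])
    ultimately show "indep_var (leb d) (X 0) (leb d) N"
      using X_meas[of 0] unfolding indep_var_eq sets_vimage_algebra by simp
    show "AE \<omega> in M. X t \<omega> = (\<lambda>i\<in>{..<d}. exp (- t) * X 0 \<omega> i + N \<omega> i)"
      using N_eq AE_space
    proof eventually_elim
      case (elim \<omega>)
      \<comment> \<open>Equality of functions on all indices is claimed; beyond \<open>d\<close>
        both sides are \<open>undefined\<close>, by membership in the product space.\<close>
      have "X t \<omega> \<in> space (leb d)"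
        using measurable_space[OF X_meas elim(2)] \<open>t > 0\<close> by simp
      then have "X t \<omega> \<in> extensional {..<d}" by (simp add: space_PiM PiE_def)
      with elim(1) show ?case
        by (intro extensionalityI[of _ "{..<d}"]) (auto simp: N_def)
    qed
    show "distr M (leb d) N = Pi\<^sub>M {..<d} (\<lambda>_. density lborel (\<lambda>x. ennreal (normal_density 0 (sqrt (1 - exp (- 2 * t))) x)))"
    proof -
      have "indep_vars (\<lambda>_. ?P) ?path {..<d}"
        using BM by (simp add: brownian_motion_def)
      then have ind: "indep_vars (\<lambda>_. lborel) (\<lambda>i \<omega>. G (?path i \<omega>)) {..<d}"
        by (rule indep_vars_compose2) simp
      have meas: "(\<lambda>\<omega>. G (?path i \<omega>)) \<in> borel_measurable M" if "i < d" for i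
        using that by (intro measurable_compose[OF path_meas G])
      have "distr M (leb d) N = Pi\<^sub>M {..<d} (\<lambda>i. distr M lborel (\<lambda>\<omega>. G (?path i \<omega>)))"
        using ind \<open>d \<ge> 1\<close> meas unfolding N_def
        by (subst (asm) indep_vars_iff_distr_eq_PiM') (auto simp: lessThan_empty_iff)
      also have "\<dots> = Pi\<^sub>M {..<d} (\<lambda>_. density lborel (\<lambda>x. ennreal (normal_density 0 (sqrt (1 - exp (- 2 * t))) x)))"
      proof (rule PiM_cong[OF refl])
        fix i assume "i \<in> {..<d}"
        then have i: "i < d" by simp
        have "AE \<omega> in M. ou_sum t (\<lambda>s. B s \<omega> i) \<longlonglongrightarrow> G (?path i \<omega>)"
          using lim N_eq by eventually_elim (use i in simp)
        from distr_ou_noise[OF B1[OF i] \<open>t > 0\<close> meas[OF i] this]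
        show "distr M lborel (\<lambda>\<omega>. G (?path i \<omega>))
            = density lborel (\<lambda>x. ennreal (normal_density 0 (sqrt (1 - exp (- 2 * t))) x))"
          by (simp cong: distr_cong)
      qed
      finally show ?thesis .
    qed
  qed
qed

text \<open>Independence makes the joint law of \<open>X 0\<close> and the noise a product measure.
  Its affine image then has independent coordinates with the convolved density
  \<open>q\<close>.\<close>

lemma ou_density:
  assumes OU: "ornstein_uhlenbeck d M B X" and "t > 0" and "d \<ge> 1"
    and m: "prob_space (density lborel (\<lambda>x. ennreal (m x)))" and [measurable]: "m \<in> borel_measurable borel"
    and init: "distr M (leb d) (X 0) = Pi\<^sub>M {..<d} (\<lambda>_. density lborel (\<lambda>x. ennreal (m x)))"
    and q: "\<And>x. ennreal (q x) = (\<integral>\<^sup>+z. ennreal (m z) *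
        ennreal (normal_density 0 (sqrt (1 - exp (- 2 * t))) (x - exp (- t) * z)) \<partial>lborel)"
      "\<And>x. q x \<ge> 0"
    and [measurable]: "q \<in> borel_measurable borel"
  shows "distributed M (leb d) (X t) (\<lambda>x. ennreal (\<Prod>i<d. q (x i)))"
proof -
  let ?n = "normal_density 0 (sqrt (1 - exp (- 2 * t)))"
  let ?A = "\<lambda>(x, y). \<lambda>i\<in>{..<d}. exp (- t) * x i + y i"
  interpret prob_space M using OU by (simp add: ornstein_uhlenbeck_def brownian_motion_def)
  have X_meas [measurable]: "X s \<in> measurable M (leb d)" if "s \<ge> 0" for s
    using OU that by (simp add: ornstein_uhlenbeck_def)
  obtain N where N: "indep_var (leb d) (X 0) (leb d) N"
    "distr M (leb d) N = Pi\<^sub>M {..<d} (\<lambda>_. density lborel (\<lambda>x. ennreal (?n x)))"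
    "AE \<omega> in M. X t \<omega> = (\<lambda>i\<in>{..<d}. exp (- t) * X 0 \<omega> i + N \<omega> i)"
    using ou_decomposition[OF OU \<open>t > 0\<close> \<open>d \<ge> 1\<close>] .
  have [measurable]: "N \<in> measurable M (leb d)" "X 0 \<in> measurable M (leb d)"
    using N(1) by (auto simp: indep_var_eq)
  have A [measurable]: "?A \<in> measurable (leb d \<Otimes>\<^sub>M leb d) (leb d)"
    by measurable
  have n: "prob_space (density lborel (\<lambda>x. ennreal (?n x)))"
    using \<open>t > 0\<close> by (intro prob_space_normal_density) simp
  note aff = distr_affine_PiM[OF _ _ _ m n q(1), of "{..<d}"]
  have "distr M (leb d) (X t) = distr M (leb d) (\<lambda>\<omega>. ?A (X 0 \<omega>, N \<omega>))"
    using N(3) \<open>t > 0\<close> by (intro distr_cong_AE) (simp_all, measurable)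
  also have "\<dots> = distr (distr M (leb d \<Otimes>\<^sub>M leb d) (\<lambda>\<omega>. (X 0 \<omega>, N \<omega>))) (leb d) ?A"
    by (subst distr_distr) (auto simp: comp_def)
  also have "distr M (leb d \<Otimes>\<^sub>M leb d) (\<lambda>\<omega>. (X 0 \<omega>, N \<omega>)) = distr M (leb d) (X 0) \<Otimes>\<^sub>M distr M (leb d) N"
    using N(1) by (simp add: indep_var_distribution_eq)
  also have "distr \<dots> (leb d) ?A = Pi\<^sub>M {..<d} (\<lambda>_. density lborel (\<lambda>x. ennreal (q x)))"
    unfolding init N(2) by (rule aff) auto
  also have "\<dots> = density (leb d) (\<lambda>x. \<Prod>i<d. ennreal (q (x i)))"
    by (intro PiM_density_lborel aff(2)) auto
  also have "(\<lambda>x. \<Prod>i<d. ennreal (q (x i))) = (\<lambda>x. ennreal (\<Prod>i<d. q (x i)))"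
    using q(2) by (simp add: prod_ennreal)
  finally show ?thesis
    using \<open>t > 0\<close> by (simp add: distributed_def)
qed

section \<open>Choice of the constants and conclusion\<close>

theorem theorem1p3:
  "\<forall>c0>0. \<exists>L>0. \<exists>c>0. \<forall>d\<ge>1. \<forall>s. s \<ge> c0 * real d \<longrightarrow>
     (\<exists>\<mu>. log_smooth d L \<mu> \<and>
        (\<forall>(M :: 'w measure) B X. ornstein_uhlenbeck d M B X \<and> distr M (leb d) (X 0) = \<mu> \<longrightarrow>
           (\<forall>t \<ge> ln 10 / 2. \<exists>p H.
              distributed M (leb d) (X t) (\<lambda>x. ennreal (p x)) \<and>
              (\<forall>x\<in>euc d. p x > 0 \<and> has_hessian d (\<lambda>y. ln (p y)) (H x) x) \<and>
              (\<exists>x\<in>euc d. op_norm d (H x) \<ge> c * (exp (- 2 * t) * s - 1)))))"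
\<comment> \<open>The witnesses are \<open>L = 3\<close>, the Lipschitz constant of one coordinate,
  and \<open>c = 1\<close>; both are independent of \<open>c0\<close>.\<close>
proof (intro allI impI, rule exI[of _ 3], intro conjI, simp, rule exI[of _ 1], intro conjI allI impI, simp)
  fix c0 s :: real and d :: nat
  assume "c0 > 0" "d \<ge> 1" "s \<ge> c0 * real d"
  moreover from this have "c0 * real d > 0" by simp
  ultimately have "s > 0" by linarith
  \<comment> \<open>The factor 2 compensates the 2 in the one-dimensional bound
    \<open>a\<^sup>2 * k / 2 - 1\<close>, which becomes
    \<open>exp (- 2 * t) * s - 1\<close>.\<close>
  define k where "k = 2 * s"
  have k: "k > 0" using \<open>s > 0\<close> by (simp add: k_def)
  define Z where "Z = (\<integral>w. exp (- well k w) \<partial>lborel)"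
  define m where "m z = exp (- well k z) / Z" for z
  define \<mu> where "\<mu> = Pi\<^sub>M {..<d} (\<lambda>_. density lborel (\<lambda>x. ennreal (m x)))"
  have m: "prob_space (density lborel (\<lambda>x. ennreal (m x)))" "log_smooth d 3 \<mu>"
    using log_smooth_well[OF k] unfolding m_def Z_def \<mu>_def by blast+
  have m_meas: "m \<in> borel_measurable borel" unfolding m_def well_def by measurable
  show "\<exists>\<mu>. log_smooth d 3 \<mu> \<and>
        (\<forall>(M :: 'w measure) B X. ornstein_uhlenbeck d M B X \<and> distr M (leb d) (X 0) = \<mu> \<longrightarrow>
           (\<forall>t \<ge> ln 10 / 2. \<exists>p H.
              distributed M (leb d) (X t) (\<lambda>x. ennreal (p x)) \<and>
              (\<forall>x\<in>euc d. p x > 0 \<and> has_hessian d (\<lambda>y. ln (p y)) (H x) x) \<and>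
              (\<exists>x\<in>euc d. op_norm d (H x) \<ge> 1 * (exp (- 2 * t) * s - 1))))"
  proof (intro exI[of _ \<mu>] conjI m(2) allI impI, elim conjE)
    fix M :: "'w measure" and B X t
    assume OU: "ornstein_uhlenbeck d M B X" and init: "distr M (leb d) (X 0) = \<mu>"
      and t: "t \<ge> ln 10 / (2 :: real)"
    have "t > 0" using t by (rule less_le_trans[rotated]) simp
    define a where "a = exp (- t)"
    have a: "a > 0" "a\<^sup>2 = exp (- 2 * t)" by (simp_all add: a_def exp_double[symmetric])
    have "exp (- 2 * t) \<le> exp (- ln 10)" using t by simp
    then have a2: "a\<^sup>2 \<le> 1 / 10" by (simp add: a(2) exp_minus inverse_eq_divide)
    obtain q u' u'' where q: "\<And>x. q x > 0" "q \<in> borel_measurable borel"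
      "\<And>x. ennreal (q x) = (\<integral>\<^sup>+z. ennreal (exp (- well k z) / (\<integral>w. exp (- well k w) \<partial>lborel))
         * ennreal (normal_density 0 (sqrt (1 - a\<^sup>2)) (x - a * z)) \<partial>lborel)"
      and d1: "\<And>x. ((\<lambda>x. ln (q x)) has_real_derivative u' x) (at x)"
      and d2: "\<And>x. (u' has_real_derivative u'' x) (at x)"
      and u'': "\<bar>u'' 0\<bar> \<ge> a\<^sup>2 * k / 2 - 1"
      by (rule diffused_well[OF k a(1) a2]) (rule that)
    have q_conv: "ennreal (q x) = (\<integral>\<^sup>+z. ennreal (m z)
         * ennreal (normal_density 0 (sqrt (1 - exp (- 2 * t))) (x - exp (- t) * z)) \<partial>lborel)" for x
      unfolding m_def Z_def a(2)[symmetric] a_def[symmetric] by (rule q(3))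
    \<comment> \<open>The origin as an element of \<open>euc d\<close>: zero below \<open>d\<close>
      and \<open>undefined\<close> beyond.\<close>
    define x0 where "x0 = (\<lambda>i\<in>{..<d}. 0 :: real)"
    have "op_norm d (\<lambda>i j. if i = j then u'' (x0 i) else 0) = \<bar>u'' 0\<bar>"
      by (rule op_norm_scalar_matrix[OF \<open>d \<ge> 1\<close>]) (simp add: x0_def)
    then have "op_norm d (\<lambda>i j. if i = j then u'' (x0 i) else 0) \<ge> 1 * (exp (- 2 * t) * s - 1)"
      using u'' by (simp add: k_def a(2))
    moreover have "x0 \<in> euc d" by (simp add: x0_def)
    moreover have "distributed M (leb d) (X t) (\<lambda>x. ennreal (\<Prod>i<d. q (x i)))"
      using q(1) by (intro ou_density[OF OU \<open>t > 0\<close> \<open>d \<ge> 1\<close> m(1) m_meas _ q_conv _ q(2)])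
        (simp_all add: init \<mu>_def less_imp_le)
    moreover have "has_hessian d (\<lambda>y. ln (\<Prod>i<d. q (y i))) (\<lambda>i j. if i = j then u'' (x i) else 0) x" for x
    proof -
      have "ln (\<Prod>i<d. q (y i)) = (\<Sum>i<d. ln (q (y i)))" for y
        using less_imp_neq[OF q(1), symmetric] by (intro ln_prod) auto
      then show ?thesis by (simp only: has_hessian_separable[OF d1 d2])
    qed
    moreover have "(\<Prod>i<d. q (x i)) > 0" for x using q(1) by (intro prod_pos) simp
    ultimately show "\<exists>p H. distributed M (leb d) (X t) (\<lambda>x. ennreal (p x)) \<and>
              (\<forall>x\<in>euc d. p x > 0 \<and> has_hessian d (\<lambda>y. ln (p y)) (H x) x) \<and>
              (\<exists>x\<in>euc d. op_norm d (H x) \<ge> 1 * (exp (- 2 * t) * s - 1))"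
      by (intro exI[of _ "\<lambda>x. \<Prod>i<d. q (x i)"] exI[of _ "\<lambda>x i j. if i = j then u'' (x i) else 0"]) blast
  qed
qed

end
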